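(* Let $p\ge 1$ be an integer and let $\boldsymbol{\beta}=(\beta_0,\ldots,\beta_{p-1})$ be a $p$-tuple of real numbers greater than $1$. The map $$\phi_{\boldsymbol{\beta}}\colon\bigcup_{i=0}^{p-1}\big(\{i\}\times[0,x_{\boldsymbol{\beta}^{(i)}})\big)\to\bigcup_{i=0}^{p-1}\big(\{i\}\times(0,x_{\boldsymbol{\beta}^{(i)}}]\big),\quad (i,x)\mapsto(i,x_{\boldsymbol{\beta}^{(i)}}-x)$$ is an isomorphism between the dynamical systems $\big(\bigcup_{i=0}^{p-1}(\{i\}\times[0,x_{\boldsymbol{\beta}^{(i)}})),\mathcal{T}_{\boldsymbol{\beta}},\mu_{\boldsymbol{\beta}},T_{\boldsymbol{\beta}}\big)$ and $\big(\bigcup_{i=0}^{p-1}(\{i\}\times(0,x_{\boldsymbol{\beta}^{(i)}}]),\mathcal{L}_{\boldsymbol{\beta}},\mu_{\boldsymbol{\beta}}\circ\phi_{\boldsymbol{\beta}}^{-1},L_{\boldsymbol{\beta}}\big)$.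
   Context: Conventions: for $n\in\mathbb{Z}$, $\beta_n=\beta_{n\bmod p}$ and $\boldsymbol{\beta}^{(n)}=(\beta_n,\ldots,\beta_{n+p-1})$. Put $x_{\boldsymbol{\beta}}=\sum_{n=0}^\infty\frac{\lceil\beta_n\rceil-1}{\prod_{k=0}^n\beta_k}$, a real number with $1\le x_{\boldsymbol{\beta}}<\infty$; $x_{\boldsymbol{\beta}^{(n)}}$ is the same quantity for the base $\boldsymbol{\beta}^{(n)}$. Extended greedy $\boldsymbol{\beta}$-transformation $T_{\boldsymbol{\beta}}$ on $\bigcup_{i=0}^{p-1}(\{i\}\times[0,x_{\boldsymbol{\beta}^{(i)}}))$: $T_{\boldsymbol{\beta}}(i,x)=((i+1)\bmod p,\ \beta_ix-\lfloor\beta_ix\rfloor)$ if $x\in[0,1)$, and $T_{\boldsymbol{\beta}}(i,x)=((i+1)\bmod p,\ \beta_ix-(\lceil\beta_i\rceil-1))$ if $x\in[1,x_{\boldsymbol{\beta}^{(i)}})$. Lazy $\boldsymbol{\beta}$-transformation $L_{\boldsymbol{\beta}}$ on $\bigcup_{i=0}^{p-1}(\{i\}\times(0,x_{\boldsymbol{\beta}^{(i)}}])$: $L_{\boldsymbol{\beta}}(i,x)=((i+1)\bmod p,\ \beta_ix)$ if $x\in(0,x_{\boldsymbol{\beta}^{(i)}}-1]$, and $L_{\boldsymbol{\beta}}(i,x)=((i+1)\bmod p,\ \beta_ix-\lceil\beta_ix-x_{\boldsymbol{\beta}^{(i+1)}}\rceil)$ if $x\in(x_{\boldsymbol{\beta}^{(i)}}-1,x_{\boldsymbol{\beta}^{(i)}}]$.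 $\mathcal{B}(A)$ is the Borel $\sigma$-algebra of $A$. $\mathcal{T}_{\boldsymbol{\beta}}$ (resp. $\mathcal{L}_{\boldsymbol{\beta}}$) is the $\sigma$-algebra of all sets $\bigcup_{i=0}^{p-1}(\{i\}\times B_i)$ with $B_i\in\mathcal{B}([0,x_{\boldsymbol{\beta}^{(i)}}))$ (resp. $B_i\in\mathcal{B}((0,x_{\boldsymbol{\beta}^{(i)}}])$) for all $i$. For a real $\beta>1$ let $T_\beta\colon[0,1)\to[0,1)$, $x\mapsto\beta x-\lfloor\beta x\rfloor$. For $i\in\{0,\ldots,p-1\}$, $\mu_{\boldsymbol{\beta},i}$ is the unique absolutely continuous (w.r.t. Lebesgue measure) probability measure on $\mathcal{B}([0,1))$ invariant under $T_{\beta_{i-1}}\circ\cdots\circ T_{\beta_{i-p}}$ (existence and uniqueness hold). The measure $\mu_{\boldsymbol{\beta}}$ on $\mathcal{T}_{\boldsymbol{\beta}}$ is $\mu_{\boldsymbol{\beta}}\big(\bigcup_{i}(\{i\}\times B_i)\big)=\frac1p\sum_{i=0}^{p-1}\mu_{\boldsymbol{\beta},i}(B_i\cap[0,1))$; it is a $T_{\boldsymbol{\beta}}$-invariant probability measure. Two dynamical systems $(X,\mathcal{F}_X,\mu_X,T_X)$ and $(Y,\mathcal{F}_Y,\mu_Y,T_Y)$ (probability spaces with measure preserving transformations) are isomorphic via $\psi$ if $\psi\colon X\to Y$ is a $\mu_X$-a.e. injective measurable map with $\mu_Y=\mu_X\circ\psi^{-1}$ and $\psi\circ T_X=T_Y\circ\psi$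 $\mu_X$-a.e. *)

theory Defs
  imports "HOL-Probability.Probability"
begin

section \<open>Dynamical systems\<close>

definition preserves_measure :: "'a measure \<Rightarrow> ('a \<Rightarrow> 'a) \<Rightarrow> bool" where
  "preserves_measure M T \<longleftrightarrow>
     T \<in> measurable M M \<and> (\<forall>A\<in>sets M. emeasure M (T -` A \<inter> space M) = emeasure M A)"

definition dynamical_system :: "'a measure \<Rightarrow> ('a \<Rightarrow> 'a) \<Rightarrow> bool" where
  "dynamical_system M T \<longleftrightarrow> prob_space M \<and> preserves_measure M T"

definition isomorphic_via ::
    "'a measure \<Rightarrow> ('a \<Rightarrow> 'a) \<Rightarrow> 'b measure \<Rightarrow> ('b \<Rightarrow> 'b) \<Rightarrow> ('a \<Rightarrow> 'b) \<Rightarrow> bool" where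
  "isomorphic_via M T N S \<psi> \<longleftrightarrow>
     dynamical_system M T \<and> dynamical_system N S \<and>
     \<psi> \<in> measurable M N \<and>
     (\<exists>Z\<in>null_sets M. inj_on \<psi> (space M - Z)) \<and>
     (\<forall>B\<in>sets N. emeasure N B = emeasure M (\<psi> -` B \<inter> space M)) \<and>
     (AE z in M. \<psi> (T z) = S (\<psi> z))"


section \<open>Alternate bases\<close>

text \<open>An alternate base is a nonempty list of reals; its length is the period. Its entries
  are indexed by all integers, modulo the period.\<close>

definition base_at :: "real list \<Rightarrow> int \<Rightarrow> real" where
  "base_at bs n = bs ! nat (n mod int (length bs))"

definition shift_base :: "real list \<Rightarrow> int \<Rightarrow> real list" where
  "shift_base bs n = map (\<lambda>k. base_at bs (n + int k)) [0..<length bs]"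

definition x_max :: "real list \<Rightarrow> real" where
  "x_max bs = (\<Sum>n. (of_int \<lceil>base_at bs (int n)\<rceil> - 1) / (\<Prod>k\<le>n. base_at bs (int k)))"

abbreviation x_shift :: "real list \<Rightarrow> nat \<Rightarrow> real" where
  "x_shift bs i \<equiv> x_max (shift_base bs (int i))"


section \<open>State spaces\<close>

definition layered_space :: "nat \<Rightarrow> (nat \<Rightarrow> real set) \<Rightarrow> (nat \<times> real) set" where
  "layered_space p X = (\<Union>i<p. {i} \<times> X i)"

definition layered_sets :: "nat \<Rightarrow> (nat \<Rightarrow> real set) \<Rightarrow> (nat \<times> real) set set" where
  "layered_sets p X =
     {\<Union>i<p. {i} \<times> B i | B. \<forall>i<p. B i \<in> sets (restrict_space borel (X i))}"

lemma mem_layered_sets_iff: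
  "A \<in> layered_sets p X \<longleftrightarrow>
     A \<subseteq> {..<p} \<times> UNIV \<and> (\<forall>i<p. Pair i -` A \<in> sets (restrict_space borel (X i)))"
proof
  assume "A \<in> layered_sets p X"
  then obtain B where A: "A = (\<Union>i<p. {i} \<times> B i)"
    and B: "\<forall>i<p. B i \<in> sets (restrict_space borel (X i))"
    by (auto simp: layered_sets_def)
  have "Pair i -` A = B i" if "i < p" for i
    using that by (auto simp: A)
  with B show "A \<subseteq> {..<p} \<times> UNIV \<and> (\<forall>i<p. Pair i -` A \<in> sets (restrict_space borel (X i)))"
    by (auto simp: A)
next
  assume *: "A \<subseteq> {..<p} \<times> UNIV \<and> (\<forall>i<p. Pair i -` A \<in> sets (restrict_space borel (X i)))"
  then have "A = (\<Union>i<p. {i} \<times> (Pair i -` A))"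
    by auto
  with * show "A \<in> layered_sets p X"
    unfolding layered_sets_def by (intro CollectI exI[of _ "\<lambda>i. Pair i -` A"]) simp
qed

lemma sigma_algebra_layered_sets: "sigma_algebra (layered_space p X) (layered_sets p X)"
  unfolding sigma_algebra_iff2
proof (intro conjI ballI allI impI)
  show "layered_sets p X \<subseteq> Pow (layered_space p X)"
    by (auto simp: layered_sets_def layered_space_def sets_restrict_space)
  show "{} \<in> layered_sets p X"
    by (auto simp: mem_layered_sets_iff)
next
  fix A assume A: "A \<in> layered_sets p X"
  have "Pair i -` (layered_space p X - A) = space (restrict_space borel (X i)) - Pair i -` A"
    if "i < p" for i
    using that by (auto simp: layered_space_def space_restrict_space)
  with A show "layered_space p X - A \<in> layered_sets p X"
    unfolding mem_layered_sets_iff by (auto simp: layered_space_def simp del: space_restrict_space)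
next
  fix A :: "nat \<Rightarrow> (nat \<times> real) set" assume A: "range A \<subseteq> layered_sets p X"
  then show "\<Union> (range A) \<in> layered_sets p X"
    unfolding mem_layered_sets_iff vimage_Union
    by (auto simp: mem_layered_sets_iff image_subset_iff intro!: sets.countable_UN)
qed

abbreviation greedy_fibre :: "real list \<Rightarrow> nat \<Rightarrow> real set" where
  "greedy_fibre bs i \<equiv> {0..<x_shift bs i}"

abbreviation lazy_fibre :: "real list \<Rightarrow> nat \<Rightarrow> real set" where
  "lazy_fibre bs i \<equiv> {0<..x_shift bs i}"


section \<open>Greedy and lazy transformations\<close>

text \<open>The maps are only meaningful on their domains, the unions of the layers
  \<open>{i} \<times> greedy_fibre bs i\<close> and \<open>{i} \<times> lazy_fibre bs i\<close>; values elsewhere are irrelevant.\<close>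

definition greedy_map :: "real list \<Rightarrow> nat \<times> real \<Rightarrow> nat \<times> real" where
  "greedy_map bs = (\<lambda>(i, x).
     (Suc i mod length bs,
      if x < 1 then base_at bs (int i) * x - of_int \<lfloor>base_at bs (int i) * x\<rfloor>
      else base_at bs (int i) * x - (of_int \<lceil>base_at bs (int i)\<rceil> - 1)))"

definition lazy_map :: "real list \<Rightarrow> nat \<times> real \<Rightarrow> nat \<times> real" where
  "lazy_map bs = (\<lambda>(i, x).
     (Suc i mod length bs,
      if x \<le> x_shift bs i - 1 then base_at bs (int i) * x
      else base_at bs (int i) * x - of_int \<lceil>base_at bs (int i) * x - x_shift bs (Suc i)\<rceil>))"

definition flip_map :: "real list \<Rightarrow> nat \<times> real \<Rightarrow> nat \<times> real" where
  "flip_map bs = (\<lambda>(i, x). (i, x_shift bs i - x))"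


section \<open>Measures\<close>

definition beta_map :: "real \<Rightarrow> real \<Rightarrow> real" where
  "beta_map \<beta> x = \<beta> * x - of_int \<lfloor>\<beta> * x\<rfloor>"

text \<open>The composition of \<open>beta_map (base_at bs (i - k))\<close> for \<open>k = 1, \<dots>, p\<close>, where
  \<open>k = p\<close> is applied first and \<open>k = 1\<close> last.\<close>

definition return_map :: "real list \<Rightarrow> nat \<Rightarrow> real \<Rightarrow> real" where
  "return_map bs i =
     foldr (\<lambda>k. beta_map (base_at bs (int i - int k))) [1..<Suc (length bs)]"

definition acip :: "real list \<Rightarrow> nat \<Rightarrow> real measure \<Rightarrow> bool" where
  "acip bs i M \<longleftrightarrow>
     sets M = sets (restrict_space borel {0..<1}) \<and>
     prob_space M \<and>
     absolutely_continuous (restrict_space lborel {0..<1}) M \<and>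
     preserves_measure M (return_map bs i)"

text \<open>For bases with all entries greater than 1, exactly one such measure exists; the
  description below is then well defined.\<close>

definition fibre_measure :: "real list \<Rightarrow> nat \<Rightarrow> real measure" where
  "fibre_measure bs i = (THE M. acip bs i M)"

definition greedy_measure :: "real list \<Rightarrow> (nat \<times> real) measure" where
  "greedy_measure bs =
     measure_of (layered_space (length bs) (greedy_fibre bs))
       (layered_sets (length bs) (greedy_fibre bs))
       (\<lambda>A. (\<Sum>i<length bs. emeasure (fibre_measure bs i) (Pair i -` A \<inter> {0..<1}))
              / of_nat (length bs))"

definition lazy_algebra :: "real list \<Rightarrow> (nat \<times> real) measure" where
  "lazy_algebra bs =
     sigma (layered_space (length bs) (lazy_fibre bs)) (layered_sets (length bs) (lazy_fibre bs))"

lemma space_greedy_measure: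
    "space (greedy_measure bs) = layered_space (length bs) (greedy_fibre bs)"
  and sets_greedy_measure:
    "sets (greedy_measure bs) = layered_sets (length bs) (greedy_fibre bs)"
  using sigma_algebra.sets_measure_of_eq[OF sigma_algebra_layered_sets]
    sigma_algebra.space_measure_of_eq[OF sigma_algebra_layered_sets]
  by (simp_all add: greedy_measure_def)

lemma space_lazy_algebra:
    "space (lazy_algebra bs) = layered_space (length bs) (lazy_fibre bs)"
  and sets_lazy_algebra:
    "sets (lazy_algebra bs) = layered_sets (length bs) (lazy_fibre bs)"
  using sigma_algebra.sets_measure_of_eq[OF sigma_algebra_layered_sets]
    sigma_algebra.space_measure_of_eq[OF sigma_algebra_layered_sets]
  by (simp_all add: lazy_algebra_def)

text \<open>The push-forward of the greedy measure under the flip, on the layered Borel sets.\<close>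

definition lazy_measure :: "real list \<Rightarrow> (nat \<times> real) measure" where
  "lazy_measure bs = distr (greedy_measure bs) (lazy_algebra bs) (flip_map bs)"

end

theory Submission
  imports Defs
begin

text \<open>
  The flip conjugates the two maps at every point, because \<open>x_shift bs i\<close> satisfies
  \<open>\<beta>\<^sub>i x\<^sub>i = \<lceil>\<beta>\<^sub>i\<rceil> - 1 + x\<^sub>i\<^sub>+\<^sub>1\<close>. The substance is that the greedy measure, defined through
  \<open>THE\<close>, is what it should be: the return maps have exactly one absolutely continuous invariant
  probability measure.

  Every branch of \<open>beta_map \<beta>\<close> is increasing and starts at the value 0, so pushing forward
  preserves nonincreasing densities \<open>f\<close>, and \<open>f 0\<close> changes to at most \<open>f 0 / \<beta> + 1\<close>. A bounded
  nonincreasing density is bounded below near 0, and the expansion spreads this lower bound over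
  the whole unit interval: the pushed density dominates a fixed multiple of the uniform one.
  Subtracting that multiple leaves again a bounded nonincreasing density, so iteration contracts
  differences of such measures geometrically, uniformly over measurable sets. Hence
  the Lebesgue measure of \<open>T\<^sup>-\<^sup>n A\<close> converges, the limit is an invariant measure, and an \<open>L\<^sup>1\<close>
  approximation by intervals shows that any absolutely continuous invariant measure equals it.
  Uniqueness also shows that \<open>beta_map \<beta>\<^sub>i\<close> carries the \<open>i\<close>-th fibre measure to the next one,
  which makes the greedy measure invariant.
\<close>

section \<open>Pushing forward nonincreasing densities\<close>

abbreviation unit_lborel :: "real measure" where
  "unit_lborel \<equiv> restrict_space lborel {0..<1}"

lemma space_unit_lborel: "space unit_lborel = {0..<1}"
  by (simp add: space_restrict_space)

lemma prob_space_unit_lborel: "prob_space unit_lborel"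
  by (rule prob_space_restrict_space) auto

lemma sets_unit_lborel: "sets unit_lborel = sets (restrict_space borel {0..<1})"
  by (simp add: sets_restrict_space)

lemma integral_const_unit: "(\<integral>x. c \<partial>unit_lborel) = (c :: real)"
  using prob_space.prob_space[OF prob_space_unit_lborel] by simp

lemma integrable_bounded_unit:
  fixes f :: "real \<Rightarrow> real"
  assumes "f \<in> borel_measurable unit_lborel" and "\<And>x. 0 \<le> x \<Longrightarrow> x < 1 \<Longrightarrow> \<bar>f x\<bar> \<le> C"
  shows "integrable unit_lborel f"
proof -
  interpret prob_space unit_lborel by (rule prob_space_unit_lborel)
  show ?thesis
    using assms by (intro integrable_const_bound[where B = C] AE_I2) (auto simp: space_unit_lborel)
qed

text \<open>Vanishing from 1 on, together with monotonicity, makes \<open>f\<close> nonnegative on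
  \<open>[0, \<infinity>)\<close>, where \<open>f 0\<close> and hence \<open>K\<close> bounds it. It
  also lets the transfer operator sum over all branches, because preimages beyond 1 contribute
  0.\<close>

definition dec_density :: "real \<Rightarrow> (real \<Rightarrow> real) \<Rightarrow> bool" where
  "dec_density K f \<longleftrightarrow> f \<in> borel_measurable borel \<and>
     (\<forall>x y. 0 \<le> x \<longrightarrow> x \<le> y \<longrightarrow> f y \<le> f x) \<and> (\<forall>x\<ge>1. f x = 0) \<and> f 0 \<le> K \<and>
     (\<integral>x. f x \<partial>unit_lborel) = 1"

lemma dec_densityD:
  assumes "dec_density K f"
  shows "f \<in> borel_measurable borel" "\<And>x y. 0 \<le> x \<Longrightarrow> x \<le> y \<Longrightarrow> f y \<le> f x"
    "\<And>x. 1 \<le> x \<Longrightarrow> f x = 0" "f 0 \<le> K" "(\<integral>x. f x \<partial>unit_lborel) = 1"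
    "\<And>x. 0 \<le> x \<Longrightarrow> 0 \<le> f x" "\<And>x. 0 \<le> x \<Longrightarrow> f x \<le> K"
proof -
  show *: "f \<in> borel_measurable borel" "\<And>x y. 0 \<le> x \<Longrightarrow> x \<le> y \<Longrightarrow> f y \<le> f x"
    "\<And>x. 1 \<le> x \<Longrightarrow> f x = 0" "f 0 \<le> K" "(\<integral>x. f x \<partial>unit_lborel) = 1"
    using assms by (auto simp: dec_density_def)
  show "0 \<le> f x" if "0 \<le> x" for x
    using *(2)[OF that, of "max 1 x"] *(3)[of "max 1 x"] by auto
  show "f x \<le> K" if "0 \<le> x" for x
    using *(2)[of 0 x] *(4) that by auto
qed

lemma dec_density_mono: "dec_density K f \<Longrightarrow> K \<le> K' \<Longrightarrow> dec_density K' f"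
  by (auto simp: dec_density_def)

lemma dec_density_integrable:
  assumes "dec_density K f" and "g \<in> borel_measurable unit_lborel"
    and "\<And>x. 0 \<le> x \<Longrightarrow> x < 1 \<Longrightarrow> \<bar>g x\<bar> \<le> C"
  shows "integrable unit_lborel (\<lambda>x. f x * g x :: real)"
proof (rule integrable_bounded_unit)
  show "(\<lambda>x. f x * g x) \<in> borel_measurable unit_lborel"
    by (intro borel_measurable_times assms(2) measurable_restrict_space1)
       (simp add: dec_densityD(1)[OF assms(1)])
  show "\<bar>f x * g x\<bar> \<le> K * C" if "0 \<le> x" "x < 1" for x
    using dec_densityD(6,7)[OF assms(1) that(1)] assms(3)[OF that]
    by (auto simp: abs_mult intro!: mult_mono)
qed

text \<open>The starting point of Doeblin's minorization condition.\<close>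

lemma dec_density_ge:
  assumes f: "dec_density K f" and "0 \<le> t" "t < 1"
  shows "1 - K * t \<le> f t"
proof -
  interpret prob_space unit_lborel by (rule prob_space_unit_lborel)
  have [measurable]: "{0..<t} \<in> sets unit_lborel"
    using assms by (auto simp: sets_restrict_space_iff)
  have m: "measure unit_lborel {0..<t} = t"
    using assms by (subst measure_restrict_space) auto
  have "1 = (\<integral>x. f x \<partial>unit_lborel)"
    by (simp add: dec_densityD(5)[OF f])
  \<comment> \<open>Left of \<open>t\<close> the density is at most \<open>K\<close>, from
    \<open>t\<close> on it is at most \<open>f t\<close>.\<close>
  also have "\<dots> \<le> (\<integral>x. f t + K * indicator {0..<t} x \<partial>unit_lborel)"
  proof (rule integral_mono)
    show "integrable unit_lborel f"
      using dec_density_integrable[OF f, of "\<lambda>_. 1" 1] by simp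
    show "integrable unit_lborel (\<lambda>x. f t + K * indicator {0..<t} x)"
      by (rule integrable_bounded_unit[where C = "\<bar>f t\<bar> + \<bar>K\<bar>"]) (auto split: split_indicator)
    show "f x \<le> f t + K * indicator {0..<t} x" if "x \<in> space unit_lborel" for x
    proof (cases "x < t")
      case True
      then show ?thesis
        using that dec_densityD(6)[OF f \<open>0 \<le> t\<close>] dec_densityD(7)[OF f, of x]
        by (auto simp: space_unit_lborel)
    next
      case False
      then show ?thesis using dec_densityD(2)[OF f \<open>0 \<le> t\<close>, of x] by auto
    qed
  qed
  also have "\<dots> = f t + K * t"
  proof (subst Bochner_Integration.integral_add)
    show "integrable unit_lborel (\<lambda>x. K * indicator {0..<t} x)"
      by (rule integrable_bounded_unit[where C = "\<bar>K\<bar>"]) (auto split: split_indicator)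
    have "(\<integral>x. indicator {0..<t} x \<partial>unit_lborel) = t"
      using m \<open>t < 1\<close> by (simp add: space_unit_lborel Int_absorb2 del: space_restrict_space)
    then show "(\<integral>x. f t \<partial>unit_lborel) + (\<integral>x. K * indicator {0..<t} x \<partial>unit_lborel) = f t + K * t"
      by (simp only: integral_const_unit integral_mult_right_zero)
  qed simp
  finally show ?thesis by simp
qed

text \<open>The clauses are chosen to survive composition. The threshold is the solution of
  \<open>K / b + 1 = K - 1\<close>, where \<open>b\<close> is a lower bound for all slopes involved.
  The gain of 1 in the bound later pays for renormalising after a subtraction. \<open>B\<close>
  stands for the slope at 0: a lower bound \<open>c\<close> on \<open>[0, t)\<close> turns into
  \<open>c / B\<close> on \<open>[0, B * t)\<close>, cut off at 1.\<close>

definition transfers :: "real \<Rightarrow> (real \<Rightarrow> real) \<Rightarrow> real \<Rightarrow> bool" where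
  "transfers b T B \<longleftrightarrow> T \<in> measurable unit_lborel unit_lborel \<and> 1 < B \<and>
     (\<forall>K f. 2 * b / (b - 1) \<le> K \<longrightarrow> dec_density K f \<longrightarrow>
       (\<exists>g. dec_density (K - 1) g \<and>
          (\<forall>A\<in>sets unit_lborel. (\<integral>x. g x * indicator A x \<partial>unit_lborel) =
             (\<integral>x. f x * indicator A (T x) \<partial>unit_lborel)) \<and>
          (\<forall>c t. (\<forall>x. 0 \<le> x \<longrightarrow> x < t \<longrightarrow> c \<le> f x) \<longrightarrow>
             (\<forall>x. 0 \<le> x \<longrightarrow> x < 1 \<longrightarrow> x < B * t \<longrightarrow> c / B \<le> g x))))"

lemma transfersD:
  assumes "transfers b T B"
  shows "T \<in> measurable unit_lborel unit_lborel" "1 < B"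
    "\<And>x. 0 \<le> x \<Longrightarrow> x < 1 \<Longrightarrow> 0 \<le> T x \<and> T x < 1"
proof -
  show *: "T \<in> measurable unit_lborel unit_lborel" "1 < B"
    using assms by (auto simp: transfers_def)
  show "0 \<le> T x \<and> T x < 1" if "0 \<le> x" "x < 1" for x
    using measurable_space[OF *(1), of x] that by (auto simp: space_unit_lborel)
qed

lemma transfersE:
  assumes "transfers b T B" "2 * b / (b - 1) \<le> K" "dec_density K f"
  obtains g where "dec_density (K - 1) g"
    "\<And>A. A \<in> sets unit_lborel \<Longrightarrow> (\<integral>x. g x * indicator A x \<partial>unit_lborel) =
             (\<integral>x. f x * indicator A (T x) \<partial>unit_lborel)"
    "\<And>c t x. (\<And>x. 0 \<le> x \<Longrightarrow> x < t \<Longrightarrow> c \<le> f x) \<Longrightarrow> 0 \<le> x \<Longrightarrow> x < 1 \<Longrightarrow> x < B * t \<Longrightarrow> c / B \<le> g x"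
  using assms unfolding transfers_def by blast

section \<open>Transfer operators of beta maps and of their compositions\<close>

lemma measurable_beta_map: "1 < \<beta> \<Longrightarrow> beta_map \<beta> \<in> measurable unit_lborel unit_lborel"
proof (rule measurable_restrict_space2)
  show "beta_map \<beta> \<in> space unit_lborel \<rightarrow> {0..<1}"
    by (auto simp: beta_map_def) linarith
  show "beta_map \<beta> \<in> measurable unit_lborel lborel"
    unfolding beta_map_def by (intro measurable_restrict_space1) simp
qed

text \<open>The witness is the transfer operator: the sum of \<open>f\<close> over the preimages,
  divided by the slope. Branches are increasing, so it keeps monotonicity; where the last branch is
  incomplete, the formal preimage lies beyond 1 and \<open>f\<close> is 0 there.\<close>

lemma transfers_beta_map:
  assumes "1 < b" and "b \<le> \<beta>"
  shows "transfers b (beta_map \<beta>) \<beta>"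
  unfolding transfers_def
proof (intro conjI allI impI measurable_beta_map)
  show "1 < \<beta>" "1 < \<beta>" using assms by auto
next
  fix K :: real and f assume K: "2 * b / (b - 1) \<le> K" and f: "dec_density K f"
  interpret prob_space unit_lborel by (rule prob_space_unit_lborel)
  have \<beta>: "1 < \<beta>" "0 < \<beta>" using assms by auto
  define N where "N = nat \<lceil>\<beta>\<rceil>"
  have N: "\<beta> \<le> real N" "0 < N" using \<beta> by (auto simp: N_def of_nat_nat)
  have Nless: "j < N" if "real j < \<beta>" for j
    using that N by linarith
  define g where "g x = (if x < 1 then (\<Sum>j<N. f ((x + real j) / \<beta>)) / \<beta> else 0)" for x
  note D = dec_densityD[OF f]
  have [measurable]: "f \<in> borel_measurable borel" by (rule D)
  have gm: "g \<in> borel_measurable borel" unfolding g_def by measurable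
  have g0: "0 \<le> g x" if "0 \<le> x" for x
    using that \<beta> by (auto simp: g_def intro!: divide_nonneg_nonneg sum_nonneg D(6))
  have g_anti: "g y \<le> g x" if "0 \<le> x" "x \<le> y" for x y
  proof (cases "y < 1")
    case True
    then show ?thesis using that \<beta>
      by (auto simp: g_def intro!: divide_right_mono sum_mono D(2))
  next
    case False then show ?thesis using g0 that by (auto simp: g_def)
  qed
  have dual: "(\<integral>x. g x * indicator A x \<partial>unit_lborel) =
             (\<integral>x. f x * indicator A (beta_map \<beta> x) \<partial>unit_lborel)" if A: "A \<in> sets unit_lborel" for A
  proof -
    have A': "A \<in> sets borel" "A \<subseteq> {0..<1}"
      using A by (auto simp: sets_restrict_space_iff)
    note [measurable] = A'(1)
    have int: "integrable lborel (\<lambda>x. f ((x + real j) / \<beta>) * indicator A x)" for j :: nat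
    proof (rule integrableI_bounded_set[where A = A and B = K])
      show "emeasure lborel A < \<infinity>"
        using emeasure_mono[OF A'(2), of lborel] by (auto simp: le_less_trans)
      have "\<bar>f ((x + real j) / \<beta>) * indicator A x\<bar> \<le> K" if "x \<in> A" for x
        using that A' D(6)[of "(x + real j) / \<beta>"] D(7)[of "(x + real j) / \<beta>"] \<beta> by auto
      then show "AE x in lborel. x \<in> A \<longrightarrow> norm (f ((x + real j) / \<beta>) * indicator A x) \<le> K"
        by auto
    qed auto
    have aff: "(\<integral>x. f x * indicator A (\<beta> * x - real j) \<partial>lborel) =
        (\<integral>x. f ((x + real j) / \<beta>) * indicator A x \<partial>lborel) / \<beta>" for j
      using \<beta> by (subst lborel_integral_real_affine[where c = "1 / \<beta>" and t = "real j / \<beta>"])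
        (auto simp: field_simps)
    have int': "integrable lborel (\<lambda>x. f x * indicator A (\<beta> * x - real j))" for j
      using \<beta> by (subst lborel_integrable_real_affine_iff[where c = "1 / \<beta>" and t = "real j / \<beta>", symmetric])
        (use int[of j] in \<open>auto simp: field_simps\<close>)
    \<comment> \<open>Among the numbers \<open>\<beta> * x - real j\<close> only the one with
      \<open>j = \<lfloor>\<beta> * x\<rfloor>\<close> lies in \<open>[0, 1)\<close>, which contains
      \<open>A\<close>. For \<open>x\<close> outside \<open>[0, 1)\<close> the sum vanishes: below 0
      by the indicators, from 1 on because \<open>f\<close> does. Each summand is then open to an
      affine substitution on the whole line.\<close>
    have split: "indicator {0..<1} x *\<^sub>R (f x * indicator A (beta_map \<beta> x)) =
        (\<Sum>j<N. f x * indicator A (\<beta> * x - real j))" for x :: real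
    proof (cases "0 \<le> x \<and> x < 1")
      case True
      define k where "k = nat \<lfloor>\<beta> * x\<rfloor>"
      have k: "real k = of_int \<lfloor>\<beta> * x\<rfloor>" using True \<beta> by (auto simp: k_def)
      have "real k < \<beta>" using True \<beta> k
        by (smt (verit) of_int_floor_le mult_less_cancel_left2)
      then have "k < N" by (rule Nless)
      have ind: "indicator A (\<beta> * x - real j) = (if j = k then indicator A (beta_map \<beta> x) else (0::real))" for j
      proof (cases "j = k")
        case False
        have "\<not> (0 \<le> \<beta> * x - real j \<and> \<beta> * x - real j < 1)"
        proof
          assume "0 \<le> \<beta> * x - real j \<and> \<beta> * x - real j < 1"
          then have "\<lfloor>\<beta> * x\<rfloor> = int j" by (intro floor_unique) auto
          then show False using False by (simp add: k_def)
        qed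
        then show ?thesis using A' False by (auto split: split_indicator)
      qed (simp add: beta_map_def k)
      then have sum: "(\<Sum>j<N. f x * indicator A (\<beta> * x - real j)) =
          (\<Sum>j<N. if j = k then f x * indicator A (beta_map \<beta> x) else 0)"
        by (intro sum.cong refl) (simp only: ind, simp)
      show ?thesis unfolding sum using True \<open>k < N\<close> by simp
    next
      case False
      have z: "f x * indicator A (\<beta> * x - real j) = 0" for j
      proof (cases "1 \<le> x")
        case False
        with \<open>\<not> (0 \<le> x \<and> x < 1)\<close> \<beta> have "\<beta> * x < 0" by (auto simp: mult_pos_neg)
        then show ?thesis using A' by (auto split: split_indicator)
      qed (simp add: D(3))
      show ?thesis unfolding z sum.neutral_const using False by (auto split: split_indicator)
    qed
    have "(\<integral>x. f x * indicator A (beta_map \<beta> x) \<partial>unit_lborel) =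
        (\<integral>x. (\<Sum>j<N. f x * indicator A (\<beta> * x - real j)) \<partial>lborel)"
      by (subst integral_restrict_space) (simp_all only: split, auto)
    also have "\<dots> = (\<Sum>j<N. (\<integral>x. f ((x + real j) / \<beta>) * indicator A x \<partial>lborel) / \<beta>)"
      by (subst Bochner_Integration.integral_sum) (auto simp: int' aff)
    also have "\<dots> = (\<integral>x. (\<Sum>j<N. f ((x + real j) / \<beta>) * indicator A x) / \<beta> \<partial>lborel)"
      by (subst integral_divide_zero, subst Bochner_Integration.integral_sum)
         (auto simp: int sum_divide_distrib)
    also have "\<dots> = (\<integral>x. indicator {0..<1} x *\<^sub>R (g x * indicator A x) \<partial>lborel)"
    proof (intro Bochner_Integration.integral_cong refl)
      fix x
      show "(\<Sum>j<N. f ((x + real j) / \<beta>) * indicator A x) / \<beta> =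
          indicator {0..<1} x *\<^sub>R (g x * indicator A x)"
      proof (cases "x \<in> A")
        case True
        then have "0 \<le> x" "x < 1" using A' by auto
        then show ?thesis using True by (simp add: g_def)
      qed simp
    qed
    also have "\<dots> = (\<integral>x. g x * indicator A x \<partial>unit_lborel)"
      by (subst integral_restrict_space) auto
    finally show ?thesis by simp
  qed
  have g1: "(\<integral>x. g x \<partial>unit_lborel) = 1"
  proof -
    have "(\<integral>x. g x \<partial>unit_lborel) = (\<integral>x. g x * indicator {0..<1} x \<partial>unit_lborel)"
      by (rule Bochner_Integration.integral_cong) (auto simp: space_unit_lborel)
    also have "\<dots> = (\<integral>x. f x * indicator {0..<1} (beta_map \<beta> x) \<partial>unit_lborel)"
      by (rule dual) (metis sets.top space_unit_lborel)
    also have "\<dots> = (\<integral>x. f x \<partial>unit_lborel)"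
      using measurable_space[OF measurable_beta_map[OF \<beta>(1)]]
      by (intro Bochner_Integration.integral_cong) (auto simp: space_unit_lborel)
    finally show ?thesis using D by simp
  qed
  \<comment> \<open>The term \<open>j = 0\<close> of \<open>g 0\<close> contributes at most
    \<open>K / \<beta>\<close>. Since \<open>x < 1\<close>, the term with index \<open>j + 1\<close>
    in \<open>g 0\<close> is at most the term with index \<open>j\<close> in \<open>g x\<close>.
    Averaging over \<open>x\<close> then bounds \<open>g 0\<close> by
    \<open>K / \<beta> + 1\<close>.\<close>
  have "g 0 \<le> K / \<beta> + g x" if x: "0 \<le> x" "x < 1" for x
  proof -
    have "(\<Sum>j<N. f (real j / \<beta>)) = f 0 + (\<Sum>j<N-1. f (real (Suc j) / \<beta>))"
      using sum.lessThan_Suc_shift[of "\<lambda>j. f (real j / \<beta>)" "N - 1"] N by simp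
    also have "\<dots> \<le> K + (\<Sum>j<N-1. f ((x + real j) / \<beta>))"
      using x \<beta> by (intro add_mono D sum_mono) (auto intro!: divide_right_mono)
    also have "\<dots> \<le> K + (\<Sum>j<N. f ((x + real j) / \<beta>))"
      using x \<beta> by (intro add_left_mono sum_mono2) (auto intro!: D)
    finally show ?thesis using x \<beta> by (simp add: g_def field_simps)
  qed
  moreover have g_int: "integrable unit_lborel g"
    using gm g0 g_anti
    by (intro integrable_bounded_unit[where C = "g 0"] measurable_restrict_space1) auto
  ultimately have "(\<integral>x. g 0 \<partial>unit_lborel) \<le> (\<integral>x. K / \<beta> + g x \<partial>unit_lborel)"
    by (intro integral_mono) (auto simp: space_unit_lborel)
  also have "\<dots> = K / \<beta> + 1"
    by (subst Bochner_Integration.integral_add[OF _ g_int])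
      (simp, simp only: g1 integral_const_unit)
  finally have "g 0 \<le> K / \<beta> + 1" by (simp only: integral_const_unit)
  also have "\<dots> \<le> K / b + 1"
  proof -
    have "0 \<le> K" using D(6)[of 0] D(4) by simp
    then show ?thesis using assms by (simp add: frac_le)
  qed
  \<comment> \<open>Equivalent to the threshold \<open>2 * b / (b - 1) \<le> K\<close>.\<close>
  also have "\<dots> \<le> K - 1"
    using K assms by (simp add: field_simps)
  finally have gK: "g 0 \<le> K - 1" .
  have low: "c / \<beta> \<le> g x" if c: "\<And>x. 0 \<le> x \<Longrightarrow> x < t \<Longrightarrow> c \<le> f x" and x: "0 \<le> x" "x < 1" "x < \<beta> * t"
    for c t x
  proof -
    \<comment> \<open>The branch at 0 alone carries the lower bound, as
      \<open>x / \<beta> < t\<close>.\<close>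
    have "c \<le> f ((x + real 0) / \<beta>)" using x \<beta> by (intro c) (auto simp: field_simps)
    also have "\<dots> \<le> (\<Sum>j<N. f ((x + real j) / \<beta>))"
      using N x \<beta> by (intro member_le_sum D) auto
    finally show ?thesis using x \<beta> by (simp add: g_def divide_right_mono)
  qed
  have "dec_density (K - 1) g"
    unfolding dec_density_def
  proof (intro conjI allI impI)
    show "g x = 0" if "1 \<le> x" for x using that by (simp add: g_def)
  qed (use gm g_anti gK g1 in auto)
  then show "\<exists>g. dec_density (K - 1) g \<and>
          (\<forall>A\<in>sets unit_lborel. (\<integral>x. g x * indicator A x \<partial>unit_lborel) =
             (\<integral>x. f x * indicator A (beta_map \<beta> x) \<partial>unit_lborel)) \<and>
          (\<forall>c t. (\<forall>x. 0 \<le> x \<longrightarrow> x < t \<longrightarrow> c \<le> f x) \<longrightarrow>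
             (\<forall>x. 0 \<le> x \<longrightarrow> x < 1 \<longrightarrow> x < \<beta> * t \<longrightarrow> c / \<beta> \<le> g x))"
    using dual low by blast
qed

text \<open>Pushing by \<open>T\<close> leaves a density with bound \<open>K - 1\<close>, hence with
  bound \<open>K\<close>, to which \<open>S\<close> applies under the same threshold. Expansion
  factors multiply.\<close>

lemma transfers_comp:
  assumes S: "transfers b S B" and T: "transfers b T C"
  shows "transfers b (S \<circ> T) (B * C)"
  unfolding transfers_def
proof (intro conjI allI impI)
  show "S \<circ> T \<in> measurable unit_lborel unit_lborel"
    using transfersD(1)[OF S] transfersD(1)[OF T] by simp
  show "1 < B * C" using transfersD(2)[OF S] transfersD(2)[OF T] by (simp add: less_1_mult)
next
  fix K f assume K: "2 * b / (b - 1) \<le> K" and f: "dec_density K f"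
  from transfersE[OF T K f] obtain g where g: "dec_density (K - 1) g"
    "\<And>A. A \<in> sets unit_lborel \<Longrightarrow> (\<integral>x. g x * indicator A x \<partial>unit_lborel) =
             (\<integral>x. f x * indicator A (T x) \<partial>unit_lborel)"
    "\<And>c t x. (\<And>x. 0 \<le> x \<Longrightarrow> x < t \<Longrightarrow> c \<le> f x) \<Longrightarrow> 0 \<le> x \<Longrightarrow> x < 1 \<Longrightarrow> x < C * t \<Longrightarrow> c / C \<le> g x"
    by blast
  have g': "dec_density K g" using g(1) by (rule dec_density_mono) simp
  from transfersE[OF S K g'] obtain h where h: "dec_density (K - 1) h"
    "\<And>A. A \<in> sets unit_lborel \<Longrightarrow> (\<integral>x. h x * indicator A x \<partial>unit_lborel) =
             (\<integral>x. g x * indicator A (S x) \<partial>unit_lborel)"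
    "\<And>c t x. (\<And>x. 0 \<le> x \<Longrightarrow> x < t \<Longrightarrow> c \<le> g x) \<Longrightarrow> 0 \<le> x \<Longrightarrow> x < 1 \<Longrightarrow> x < B * t \<Longrightarrow> c / B \<le> h x"
    by blast
  have "(\<integral>x. h x * indicator A x \<partial>unit_lborel) = (\<integral>x. f x * indicator A ((S \<circ> T) x) \<partial>unit_lborel)"
    if A: "A \<in> sets unit_lborel" for A
  proof -
    let ?A = "S -` A \<inter> space unit_lborel"
    have "(\<integral>x. g x * indicator A (S x) \<partial>unit_lborel) = (\<integral>x. g x * indicator ?A x \<partial>unit_lborel)"
      by (rule Bochner_Integration.integral_cong) (auto split: split_indicator)
    also have "\<dots> = (\<integral>x. f x * indicator ?A (T x) \<partial>unit_lborel)"
      by (rule g) (use A transfersD(1)[OF S] in \<open>rule measurable_sets[rotated]\<close>)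
    also have "\<dots> = (\<integral>x. f x * indicator A ((S \<circ> T) x) \<partial>unit_lborel)"
      using transfersD(3)[OF T]
      by (intro Bochner_Integration.integral_cong) (auto simp: space_unit_lborel split: split_indicator)
    finally show ?thesis using h(2)[OF A] by simp
  qed
  moreover have "c / (B * C) \<le> h x"
    if c: "\<forall>x. 0 \<le> x \<longrightarrow> x < t \<longrightarrow> c \<le> f x" and x: "0 \<le> x" "x < 1" "x < B * C * t" for c t x
  proof -
    have "c / C / B \<le> h x"
    \<comment> \<open>The lower bound for \<open>g\<close> is known only inside
      \<open>[0, 1)\<close>, so the interval is cut at 1; its image still reaches \<open>x\<close>,
      because \<open>x < 1 < B\<close>.\<close>
    proof (rule h(3)[where t = "min 1 (C * t)"])
      show "c / C \<le> g y" if "0 \<le> y" "y < min 1 (C * t)" for y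
        using that c by (intro g(3)[of t]) auto
      show "x < B * min 1 (C * t)"
        using x transfersD(2)[OF S] by (auto simp: min_def mult.assoc)
    qed (use x in auto)
    then show ?thesis by (simp add: mult.commute)
  qed
  ultimately show "\<exists>g. dec_density (K - 1) g \<and>
          (\<forall>A\<in>sets unit_lborel. (\<integral>x. g x * indicator A x \<partial>unit_lborel) =
             (\<integral>x. f x * indicator A ((S \<circ> T) x) \<partial>unit_lborel)) \<and>
          (\<forall>c t. (\<forall>x. 0 \<le> x \<longrightarrow> x < t \<longrightarrow> c \<le> f x) \<longrightarrow>
             (\<forall>x. 0 \<le> x \<longrightarrow> x < 1 \<longrightarrow> x < B * C * t \<longrightarrow> c / (B * C) \<le> g x))"
    using h(1) by blast
qed

text \<open>The exponent starts at 1: the identity has factor \<open>B ^ 0 = 1\<close>, which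
  violates \<open>1 < B\<close>.\<close>

lemma transfers_funpow:
  assumes "transfers b T B"
  shows "transfers b (T ^^ Suc n) (B ^ Suc n)"
proof (induction n)
  case (Suc n)
  then show ?case using transfers_comp[OF assms Suc.IH] by (simp add: comp_def)
qed (use assms in simp)

section \<open>Contraction\<close>

lemma dec_density_indicator_integral:
  assumes f: "dec_density K f" and A: "A \<in> sets unit_lborel"
  shows "0 \<le> (\<integral>x. f x * indicator A x \<partial>unit_lborel)"
    and "(\<integral>x. f x * indicator A x \<partial>unit_lborel) \<le> 1"
    and "(\<integral>x. f x * indicator A x \<partial>unit_lborel) \<le> K * measure unit_lborel A"
proof -
  interpret prob_space unit_lborel by (rule prob_space_unit_lborel)
  note [measurable] = A
  have i: "integrable unit_lborel (\<lambda>x. f x * indicator A x)"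
    by (rule dec_density_integrable[OF f, where C = 1]) (auto split: split_indicator)
  have i1: "integrable unit_lborel f"
    using dec_density_integrable[OF f, of "\<lambda>_. 1" 1] by simp
  show "0 \<le> (\<integral>x. f x * indicator A x \<partial>unit_lborel)"
    using dec_densityD(6)[OF f] by (intro integral_nonneg_AE AE_I2) (auto simp: space_unit_lborel)
  have "(\<integral>x. f x * indicator A x \<partial>unit_lborel) \<le> (\<integral>x. f x \<partial>unit_lborel)"
    using dec_densityD(6)[OF f]
    by (intro integral_mono i i1) (auto simp: space_unit_lborel split: split_indicator)
  then show "(\<integral>x. f x * indicator A x \<partial>unit_lborel) \<le> 1"
    by (simp add: dec_densityD(5)[OF f])
  have "(\<integral>x. f x * indicator A x \<partial>unit_lborel) \<le> (\<integral>x. K * indicator A x \<partial>unit_lborel)"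
    using dec_densityD(7)[OF f]
    by (intro integral_mono i) (auto simp: space_unit_lborel split: split_indicator
        intro!: integrable_mult_right integrable_real_indicator emeasure_finite A simp: less_top[symmetric])
  also have "\<dots> = K * measure unit_lborel A"
    using A sets.sets_into_space[OF A]
    by (simp add: Int_absorb2 del: space_restrict_space)
  finally show "(\<integral>x. f x * indicator A x \<partial>unit_lborel) \<le> K * measure unit_lborel A" .
qed

lemma transfers_funpow_measurable:
  assumes "transfers b T B"
  shows "T ^^ n \<in> measurable unit_lborel unit_lborel"
proof (induction n)
  case (Suc n)
  show ?case unfolding funpow.simps using Suc transfersD(1)[OF assms] by (rule measurable_comp)
qed (simp add: id_def)

lemma transfers_vimage:
  assumes "transfers b T B" and "A \<in> sets unit_lborel"
  shows "(T ^^ n) -` A \<inter> space unit_lborel \<in> sets unit_lborel"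
  using transfers_funpow_measurable[OF assms(1)] assms(2) by (rule measurable_sets)

lemma integral_vimage_unit:
  "(\<integral>x. f x * indicator (S -` A \<inter> space unit_lborel) x \<partial>unit_lborel) =
   (\<integral>x. (f x :: real) * indicator A (S x) \<partial>unit_lborel)"
  by (rule Bochner_Integration.integral_cong) (auto split: split_indicator)

text \<open>Keeps all iterates within one class of densities. The bound is \<open>K\<close> rather
  than \<open>K - 1\<close> so that \<open>k = 0\<close> is covered, with \<open>f\<close> itself as
  the witness.\<close>

lemma transfers_push:
  assumes T: "transfers b T B" and K: "2 * b / (b - 1) \<le> K" and f: "dec_density K f"
  obtains g where "dec_density K g"
    "\<And>A. A \<in> sets unit_lborel \<Longrightarrow> (\<integral>x. g x * indicator A x \<partial>unit_lborel) =
             (\<integral>x. f x * indicator A ((T ^^ k) x) \<partial>unit_lborel)"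
proof (cases k)
  case 0
  show ?thesis by (rule that[OF f]) (simp add: 0)
next
  case (Suc n)
  show ?thesis
  proof (rule transfersE[OF transfers_funpow[OF T, of n] K f])
    fix g assume g: "dec_density (K - 1) g"
      and dual: "\<And>A. A \<in> sets unit_lborel \<Longrightarrow> (\<integral>x. g x * indicator A x \<partial>unit_lborel) =
             (\<integral>x. f x * indicator A ((T ^^ Suc n) x) \<partial>unit_lborel)"
    have "dec_density K g" using g by (rule dec_density_mono) simp
    then show ?thesis by (rule that) (simp only: dual Suc)
  qed
qed

text \<open>Some iterate of \<open>T\<close> spreads the interval near 0, on which \<open>f\<close> is at least \<open>1/2\<close>,
  over the whole unit interval.\<close>

lemma transfers_minorization:
  assumes T: "transfers b T B" and "1 < b" and K: "2 * b / (b - 1) \<le> K"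
  obtains m e where "0 < e" "e < 1"
    "\<And>f. dec_density K f \<Longrightarrow> \<exists>g. dec_density K g \<and>
      (\<forall>A\<in>sets unit_lborel. (\<integral>x. f x * indicator A ((T ^^ Suc m) x) \<partial>unit_lborel) =
         e * measure unit_lborel A + (1 - e) * (\<integral>x. g x * indicator A x \<partial>unit_lborel))"
proof -
  interpret prob_space unit_lborel by (rule prob_space_unit_lborel)
  have "2 \<le> 2 * b / (b - 1)" using \<open>1 < b\<close> by (simp add: field_simps)
  with K have K2: "2 \<le> K" by simp
  have B: "1 < B" by (rule transfersD[OF T])
  \<comment> \<open>Chosen so that \<open>[0, 1 / (2 * K))\<close>, expanded by the factor
    \<open>C\<close>, covers the unit interval.\<close>
  then obtain m where m: "2 * K < B ^ m" using real_arch_pow by blast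
  define C where "C = B ^ Suc m"
  have C: "2 * K < C" using m B K2 unfolding C_def power_Suc
    by (smt (verit) mult_le_cancel_right1)
  \<comment> \<open>The first bound puts \<open>e\<close> below the minorant
    \<open>1 / 2 / C\<close> of the pushed density. The second gives \<open>K * e \<le> 1\<close>,
    so that the gain of 1 in \<open>g 0 \<le> K - 1\<close> absorbs the division by
    \<open>1 - e\<close>.\<close>
  define e where "e = min (1 / (2 * C)) (1 / K)"
  have e: "0 < e" "e \<le> 1 / (2 * C)" "e \<le> 1 / K" using C K2 by (auto simp: e_def)
  have "1 / K \<le> 1 / 2" using K2 by (simp add: field_simps)
  then have e1: "e < 1" using e by simp
  show ?thesis
  proof (rule that[of e m])
    fix f assume f: "dec_density K f"
    from transfersE[OF transfers_funpow[OF T, of m] K f] obtain g where g: "dec_density (K - 1) g"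
      "\<And>A. A \<in> sets unit_lborel \<Longrightarrow> (\<integral>x. g x * indicator A x \<partial>unit_lborel) =
               (\<integral>x. f x * indicator A ((T ^^ Suc m) x) \<partial>unit_lborel)"
      "\<And>c t x. (\<And>x. 0 \<le> x \<Longrightarrow> x < t \<Longrightarrow> c \<le> f x) \<Longrightarrow> 0 \<le> x \<Longrightarrow> x < 1 \<Longrightarrow> x < C * t \<Longrightarrow> c / C \<le> g x"
      unfolding C_def by blast
    note D = dec_densityD[OF g(1)]
    have ge: "e \<le> g x" if "0 \<le> x" "x < 1" for x
    proof -
      have "1 / 2 / C \<le> g x"
      proof (rule g(3))
        show "1 / 2 \<le> f y" if y: "0 \<le> y" "y < 1 / (2 * K)" for y
        proof -
          have "K * y < 1 / 2" using y K2 by (simp add: field_simps)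
          moreover have "y < 1" using y K2 by (smt (verit) divide_le_eq_1)
          ultimately show ?thesis using dec_density_ge[OF f y(1)] by simp
        qed
        show "x < C * (1 / (2 * K))"
        proof -
          have "1 < C * (1 / (2 * K))" using C K2 by (simp add: field_simps)
          then show ?thesis using \<open>x < 1\<close> by simp
        qed
      qed (use that in auto)
      then show ?thesis using e by simp
    qed
    \<comment> \<open>What remains after removing \<open>e\<close> times the uniform density,
      rescaled to integral 1 and extended by 0 from 1 on.\<close>
    define h where "h x = (if x < 1 then (g x - e) / (1 - e) else 0)" for x
    have gi: "integrable unit_lborel g"
      using dec_density_integrable[OF g(1), of "\<lambda>_. 1" 1] by simp
    have h1: "(\<integral>x. h x \<partial>unit_lborel) = 1"
    proof -
      have "(\<integral>x. h x \<partial>unit_lborel) = (\<integral>x. (g x - e) / (1 - e) \<partial>unit_lborel)"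
        by (rule Bochner_Integration.integral_cong) (auto simp: h_def space_unit_lborel)
      also have "\<dots> = ((\<integral>x. g x \<partial>unit_lborel) - (\<integral>x. e \<partial>unit_lborel)) / (1 - e)"
        unfolding integral_divide_zero
        by (subst Bochner_Integration.integral_diff) (use gi in auto)
      also have "\<dots> = 1" using e1 by (simp only: D(5) integral_const_unit) simp
      finally show ?thesis .
    qed
    have "dec_density K h"
      unfolding dec_density_def
    proof (intro conjI allI impI)
      have [measurable]: "g \<in> borel_measurable borel" by (rule D)
      show "h \<in> borel_measurable borel" unfolding h_def by measurable
      show "h y \<le> h x" if "0 \<le> x" "x \<le> y" for x y
      proof (cases "y < 1")
        case True
        then show ?thesis using that e1 D(2)[OF that] by (auto simp: h_def divide_right_mono)
      next
        case False then show ?thesis using e1 ge[OF that(1)] by (auto simp: h_def)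
      qed
      have "K * e \<le> 1" using e(3) K2 by (simp add: field_simps)
      then have "g 0 \<le> K - K * e" using D(4) by simp
      then have "g 0 - e \<le> K * (1 - e)" using e by (simp add: algebra_simps)
      then show "h 0 \<le> K" using e1 by (simp add: h_def field_simps)
      show "h x = 0" if "1 \<le> x" for x using that by (simp add: h_def)
    qed (rule h1)
    moreover have "(\<integral>x. f x * indicator A ((T ^^ Suc m) x) \<partial>unit_lborel) =
         e * measure unit_lborel A + (1 - e) * (\<integral>x. h x * indicator A x \<partial>unit_lborel)"
      if A: "A \<in> sets unit_lborel" for A
    proof -
      have ih: "integrable unit_lborel (\<lambda>x. h x * indicator A x)"
        by (rule dec_density_integrable[OF \<open>dec_density K h\<close> borel_measurable_indicator[OF A], where C = 1])
          (simp add: indicator_def)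
      have "(\<integral>x. g x * indicator A x \<partial>unit_lborel) =
          (\<integral>x. e * indicator A x + (1 - e) * (h x * indicator A x) \<partial>unit_lborel)"
        using e1 by (intro Bochner_Integration.integral_cong)
          (auto simp: h_def space_unit_lborel split: split_indicator)
      also have "\<dots> = (\<integral>x. e * indicator A x \<partial>unit_lborel)
          + (\<integral>x. (1 - e) * (h x * indicator A x) \<partial>unit_lborel)"
        by (intro Bochner_Integration.integral_add integrable_mult_right ih integrable_real_indicator A)
          (simp add: less_top[symmetric] emeasure_finite)
      also have "(\<integral>x. e * indicator A x \<partial>unit_lborel) = e * measure unit_lborel A"
        using A sets.sets_into_space[OF A] by (simp add: Int_absorb2 del: space_restrict_space)
      finally show ?thesis using g(2)[OF A] by simp
    qed
    ultimately show "\<exists>g. dec_density K g \<and>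
      (\<forall>A\<in>sets unit_lborel. (\<integral>x. f x * indicator A ((T ^^ Suc m) x) \<partial>unit_lborel) =
         e * measure unit_lborel A + (1 - e) * (\<integral>x. g x * indicator A x \<partial>unit_lborel))"
      by blast
  qed (use e e1 in auto)
qed

text \<open>Each block of \<open>Suc m\<close> steps splits off the same multiple \<open>e\<close>
  of Lebesgue measure from both densities, which cancels in the difference, and leaves densities of
  the same class with weight \<open>1 - e\<close>. The choice of \<open>n0\<close> is uniform in the
  densities, so it also serves densities that have already been pushed forward.\<close>

lemma transfers_contraction:
  assumes T: "transfers b T B" and b: "1 < b" and K: "2 * b / (b - 1) \<le> K" and "0 < d"
  obtains n0 where "\<And>n f g A. n0 \<le> n \<Longrightarrow> dec_density K f \<Longrightarrow> dec_density K g \<Longrightarrow> A \<in> sets unit_lborel \<Longrightarrow>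
     \<bar>(\<integral>x. f x * indicator A ((T ^^ n) x) \<partial>unit_lborel) - (\<integral>x. g x * indicator A ((T ^^ n) x) \<partial>unit_lborel)\<bar> < d"
proof -
  obtain m e where e: "0 < e" "e < 1" and
    split: "\<And>f. dec_density K f \<Longrightarrow> \<exists>g. dec_density K g \<and>
      (\<forall>A\<in>sets unit_lborel. (\<integral>x. f x * indicator A ((T ^^ Suc m) x) \<partial>unit_lborel) =
         e * measure unit_lborel A + (1 - e) * (\<integral>x. g x * indicator A x \<partial>unit_lborel))"
    by (rule transfers_minorization[OF T b K]) (rule that; blast)
  define S where "S = T ^^ Suc m"
  note split = split[folded S_def]
  have S: "transfers b S (B ^ Suc m)" unfolding S_def by (rule transfers_funpow[OF T])
  have contr: "\<bar>(\<integral>x. f x * indicator A ((S ^^ n) x) \<partial>unit_lborel)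
      - (\<integral>x. g x * indicator A ((S ^^ n) x) \<partial>unit_lborel)\<bar> \<le> (1 - e) ^ n"
    if "dec_density K f" "dec_density K g" "A \<in> sets unit_lborel" for f g A n
    using that
  proof (induction n arbitrary: f g)
    case 0
    then show ?case
      using dec_density_indicator_integral(1,2)[of K f A] dec_density_indicator_integral(1,2)[of K g A]
      by auto
  next
    case (Suc n)
    let ?A = "(S ^^ n) -` A \<inter> space unit_lborel"
    have A': "?A \<in> sets unit_lborel" by (rule transfers_vimage[OF S Suc.prems(3)])
    have step: "(\<integral>x. f x * indicator A ((S ^^ Suc n) x) \<partial>unit_lborel) =
        (\<integral>x. f x * indicator ?A (S x) \<partial>unit_lborel)" for f :: "real \<Rightarrow> real"
    proof (intro Bochner_Integration.integral_cong refl)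
      fix x assume "x \<in> space unit_lborel"
      then have "S x \<in> space unit_lborel" using transfersD(3)[OF S, of x] by (simp add: space_unit_lborel)
      then show "f x * indicator A ((S ^^ Suc n) x) = f x * indicator ?A (S x)"
        unfolding funpow_Suc_right comp_apply by (simp only: indicator_def vimage_def) simp
    qed
    from split[OF Suc.prems(1)] obtain f' where f': "dec_density K f'"
      "\<And>A. A \<in> sets unit_lborel \<Longrightarrow> (\<integral>x. f x * indicator A (S x) \<partial>unit_lborel) =
         e * measure unit_lborel A + (1 - e) * (\<integral>x. f' x * indicator A x \<partial>unit_lborel)" by blast
    from split[OF Suc.prems(2)] obtain g' where g': "dec_density K g'"
      "\<And>A. A \<in> sets unit_lborel \<Longrightarrow> (\<integral>x. g x * indicator A (S x) \<partial>unit_lborel) =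
         e * measure unit_lborel A + (1 - e) * (\<integral>x. g' x * indicator A x \<partial>unit_lborel)" by blast
    have "(\<integral>x. f x * indicator A ((S ^^ Suc n) x) \<partial>unit_lborel)
      - (\<integral>x. g x * indicator A ((S ^^ Suc n) x) \<partial>unit_lborel) =
      (1 - e) * ((\<integral>x. f' x * indicator A ((S ^^ n) x) \<partial>unit_lborel)
        - (\<integral>x. g' x * indicator A ((S ^^ n) x) \<partial>unit_lborel))"
      unfolding step f'(2)[OF A'] g'(2)[OF A'] integral_vimage_unit by (simp add: algebra_simps)
    then show ?case
      using Suc.IH[OF f'(1) g'(1) Suc.prems(3)] e by (simp add: abs_mult mult_left_mono)
  qed
  obtain q where q: "(1 - e) ^ q < d"
    using real_arch_pow_inv[of d "1 - e"] \<open>0 < d\<close> e by auto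
  show ?thesis
  proof (rule that[of "Suc m * q"])
    fix n f g A assume n: "Suc m * q \<le> n" and f: "dec_density K f" and g: "dec_density K g"
      and A: "A \<in> sets unit_lborel"
    \<comment> \<open>The surplus steps are performed first and absorbed into the densities, which
      stay in the class; the \<open>q\<close> full blocks then contract.\<close>
    define k where "k = n - Suc m * q"
    let ?A = "(S ^^ q) -` A \<inter> space unit_lborel"
    have A': "?A \<in> sets unit_lborel" by (rule transfers_vimage[OF S A])
    have "n = Suc m * q + k" using n by (simp add: k_def)
    then have Tn: "(T ^^ n) x = (S ^^ q) ((T ^^ k) x)" for x
      by (simp only: funpow_add S_def funpow_mult comp_def)
    have step: "(\<integral>x. f x * indicator A ((T ^^ n) x) \<partial>unit_lborel) =
        (\<integral>x. f x * indicator ?A ((T ^^ k) x) \<partial>unit_lborel)" for f :: "real \<Rightarrow> real"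
    proof (intro Bochner_Integration.integral_cong refl)
      fix x assume "x \<in> space unit_lborel"
      then have "(T ^^ k) x \<in> space unit_lborel"
        by (rule measurable_space[OF transfers_funpow_measurable[OF T]])
      then show "f x * indicator A ((T ^^ n) x) = f x * indicator ?A ((T ^^ k) x)"
        unfolding Tn by (simp only: indicator_def vimage_def) simp
    qed
    from transfers_push[OF T K f, of k] obtain f' where f': "dec_density K f'"
      "\<And>A. A \<in> sets unit_lborel \<Longrightarrow> (\<integral>x. f' x * indicator A x \<partial>unit_lborel) =
             (\<integral>x. f x * indicator A ((T ^^ k) x) \<partial>unit_lborel)" by blast
    from transfers_push[OF T K g, of k] obtain g' where g': "dec_density K g'"
      "\<And>A. A \<in> sets unit_lborel \<Longrightarrow> (\<integral>x. g' x * indicator A x \<partial>unit_lborel) =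
             (\<integral>x. g x * indicator A ((T ^^ k) x) \<partial>unit_lborel)" by blast
    show "\<bar>(\<integral>x. f x * indicator A ((T ^^ n) x) \<partial>unit_lborel) - (\<integral>x. g x * indicator A ((T ^^ n) x) \<partial>unit_lborel)\<bar> < d"
      unfolding step f'(2)[OF A', symmetric] g'(2)[OF A', symmetric] integral_vimage_unit
      using contr[OF f'(1) g'(1) A, of q] q by simp
  qed
qed

section \<open>Equidistribution\<close>

text \<open>The value \<open>a = 1\<close> gives the uniform density; the other values lead to the
  intervals that generate the Borel sets.\<close>

lemma dec_density_interval:
  assumes "0 < a" "a \<le> 1"
  shows "dec_density (1 / a) (\<lambda>x. indicator {..<a} x / a)"
  unfolding dec_density_def
proof (intro conjI allI impI)
  have "{0..<a} \<in> sets unit_lborel" using assms by (auto simp: sets_restrict_space_iff)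
  have "(\<integral>x. indicator {..<a} x / a \<partial>unit_lborel) = (\<integral>x. indicator {0..<a} x \<partial>unit_lborel) / a"
    unfolding integral_divide_zero
    by (intro arg_cong2[where f = "(/)"] Bochner_Integration.integral_cong)
      (auto simp: space_unit_lborel split: split_indicator)
  also have "(\<integral>x. indicator {0..<a} x \<partial>unit_lborel) = measure unit_lborel {0..<a}"
    using assms by (simp add: space_unit_lborel Int_absorb2 del: space_restrict_space)
  also have "\<dots> = a"
    using assms by (subst measure_restrict_space) auto
  finally show "(\<integral>x. indicator {..<a} x / a \<partial>unit_lborel) = 1" using assms by simp
qed (use assms in \<open>auto split: split_indicator\<close>)

section \<open>Limits of the Lebesgue measure of iterated preimages\<close>

definition asymptotic_measure :: "(real \<Rightarrow> real) \<Rightarrow> real set \<Rightarrow> real" where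
  "asymptotic_measure T A = lim (\<lambda>n. measure unit_lborel ((T ^^ n) -` A \<inter> space unit_lborel))"

text \<open>The factor is written \<open>indicator {..<1} x / 1\<close> to be literally the density
  of \<open>dec_density_interval\<close> at \<open>a = 1\<close>.\<close>

lemma measure_vimage_eq_integral:
  assumes T: "transfers b T B" and A: "A \<in> sets unit_lborel"
  shows "measure unit_lborel ((T ^^ n) -` A \<inter> space unit_lborel) =
    (\<integral>x. indicator {..<1} x / 1 * indicator A ((T ^^ n) x) \<partial>unit_lborel)"
proof -
  have "measure unit_lborel ((T ^^ n) -` A \<inter> space unit_lborel) =
      (\<integral>x. 1 * indicator ((T ^^ n) -` A \<inter> space unit_lborel) x \<partial>unit_lborel)"
    by simp
  also have "\<dots> = (\<integral>x. 1 * indicator A ((T ^^ n) x) \<partial>unit_lborel)"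
    by (rule integral_vimage_unit)
  also have "\<dots> = (\<integral>x. indicator {..<1} x / 1 * indicator A ((T ^^ n) x) \<partial>unit_lborel)"
    by (rule Bochner_Integration.integral_cong) (auto simp: space_unit_lborel)
  finally show ?thesis .
qed

lemma funpow_vimage:
  assumes T: "transfers b T B"
  shows "(T ^^ (m + n)) -` A \<inter> space unit_lborel =
    (T ^^ n) -` ((T ^^ m) -` A \<inter> space unit_lborel) \<inter> space unit_lborel"
  using measurable_space[OF transfers_funpow_measurable[OF T, of n]] by (auto simp: funpow_add)

text \<open>Lebesgue measure after \<open>n0 + k\<close> steps is some density of the same class
  after \<open>n0\<close> steps. Contraction compares it with the uniform density after
  \<open>n0\<close> steps, uniformly in \<open>k\<close>. So the sequence is Cauchy, and the
  \<open>lim\<close> in \<open>asymptotic_measure\<close> is a genuine limit.\<close>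

lemma asymptotic_measure_LIMSEQ:
  assumes T: "transfers b T B" and b: "1 < b" and A: "A \<in> sets unit_lborel"
  shows "(\<lambda>n. measure unit_lborel ((T ^^ n) -` A \<inter> space unit_lborel)) \<longlonglongrightarrow> asymptotic_measure T A"
    (is "?a \<longlonglongrightarrow> _")
proof -
  define K where "K = 2 * b / (b - 1)"
  have K: "2 * b / (b - 1) \<le> K" by (simp add: K_def)
  have K1: "1 \<le> K" using b by (simp add: K_def field_simps)
  let ?u = "\<lambda>x. indicator {..<1} x / 1 :: real"
  have u: "dec_density K ?u"
    using dec_density_interval[of 1] K1 by (auto intro: dec_density_mono)
  have "Cauchy ?a"
  proof (rule metric_CauchyI)
    fix d :: real assume "0 < d"
    then have "0 < d / 2" by simp
    from transfers_contraction[OF T b K this] obtain n0 where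
      n0: "\<And>n f g A. n0 \<le> n \<Longrightarrow> dec_density K f \<Longrightarrow> dec_density K g \<Longrightarrow> A \<in> sets unit_lborel \<Longrightarrow>
     \<bar>(\<integral>x. f x * indicator A ((T ^^ n) x) \<partial>unit_lborel) - (\<integral>x. g x * indicator A ((T ^^ n) x) \<partial>unit_lborel)\<bar> < d / 2"
      by blast
    have near: "\<bar>?a n - ?a n0\<bar> < d / 2" if "n0 \<le> n" for n
    proof -
      define k where "k = n - n0"
      have n: "n = n0 + k" using that by (simp add: k_def)
      let ?A = "(T ^^ n0) -` A \<inter> space unit_lborel"
      have A': "?A \<in> sets unit_lborel" by (rule transfers_vimage[OF T A])
      obtain g where g: "dec_density K g"
        "(\<integral>x. g x * indicator ?A x \<partial>unit_lborel) = (\<integral>x. ?u x * indicator ?A ((T ^^ k) x) \<partial>unit_lborel)"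
        by (rule transfers_push[OF T K u, of k]) (use A' in blast)
      have "?a n = (\<integral>x. g x * indicator A ((T ^^ n0) x) \<partial>unit_lborel)"
        unfolding n funpow_vimage[OF T] measure_vimage_eq_integral[OF T A'] g(2)[symmetric]
        by (rule integral_vimage_unit)
      moreover have "?a n0 = (\<integral>x. ?u x * indicator A ((T ^^ n0) x) \<partial>unit_lborel)"
        by (rule measure_vimage_eq_integral[OF T A])
      ultimately show ?thesis using n0[OF order_refl g(1) u A] by simp
    qed
    show "\<exists>M. \<forall>m\<ge>M. \<forall>n\<ge>M. dist (?a m) (?a n) < d"
    proof (intro exI allI impI)
      fix m n assume "n0 \<le> m" "n0 \<le> n"
      from near[OF this(1)] near[OF this(2)] show "dist (?a m) (?a n) < d"
        unfolding dist_real_def by linarith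
    qed
  qed
  then show ?thesis
    unfolding asymptotic_measure_def by (simp only: Cauchy_convergent_iff convergent_LIMSEQ_iff)
qed

text \<open>Contraction makes the difference to the uniform density vanish, so both share the
  limit.\<close>

lemma asymptotic_measure_dec_density:
  assumes T: "transfers b T B" and b: "1 < b" and A: "A \<in> sets unit_lborel" and f: "dec_density K f"
  shows "(\<lambda>n. \<integral>x. f x * indicator A ((T ^^ n) x) \<partial>unit_lborel) \<longlonglongrightarrow> asymptotic_measure T A"
proof -
  \<comment> \<open>Large enough for the contraction threshold, for \<open>f\<close> and for the
    uniform density at once.\<close>
  define K' where "K' = max K (max 1 (2 * b / (b - 1)))"
  have K': "2 * b / (b - 1) \<le> K'" "K \<le> K'" "1 \<le> K'" by (auto simp: K'_def)
  have f': "dec_density K' f" using f K'(2) by (rule dec_density_mono)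
  let ?u = "\<lambda>x. indicator {..<1} x / 1 :: real"
  have u: "dec_density K' ?u"
    using dec_density_interval[of 1] K' by (auto intro: dec_density_mono)
  have "(\<lambda>n. (\<integral>x. f x * indicator A ((T ^^ n) x) \<partial>unit_lborel)
      - (\<integral>x. ?u x * indicator A ((T ^^ n) x) \<partial>unit_lborel)) \<longlonglongrightarrow> 0"
  proof (rule LIMSEQ_I)
    fix d :: real assume "0 < d"
    from transfers_contraction[OF T b K'(1) this] obtain n0 where
      n0: "\<And>n f g A. n0 \<le> n \<Longrightarrow> dec_density K' f \<Longrightarrow> dec_density K' g \<Longrightarrow> A \<in> sets unit_lborel \<Longrightarrow>
     \<bar>(\<integral>x. f x * indicator A ((T ^^ n) x) \<partial>unit_lborel) - (\<integral>x. g x * indicator A ((T ^^ n) x) \<partial>unit_lborel)\<bar> < d"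
      by blast
    show "\<exists>no. \<forall>n\<ge>no. norm ((\<integral>x. f x * indicator A ((T ^^ n) x) \<partial>unit_lborel)
      - (\<integral>x. ?u x * indicator A ((T ^^ n) x) \<partial>unit_lborel) - 0) < d"
      unfolding diff_0_right real_norm_def using n0[OF _ f' u A] by blast
  qed
  from tendsto_add[OF this asymptotic_measure_LIMSEQ[OF T b A]] show ?thesis
    unfolding measure_vimage_eq_integral[OF T A] by simp
qed

text \<open>All pushes of the uniform density obey the same bound, which passes to the limit. This
  later yields absolute continuity and continuity at the empty set.\<close>

lemma asymptotic_measure_le:
  assumes T: "transfers b T B" and b: "1 < b" and A: "A \<in> sets unit_lborel"
  shows "0 \<le> asymptotic_measure T A" "asymptotic_measure T A \<le> 2 * b / (b - 1) * measure unit_lborel A"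
proof -
  show "0 \<le> asymptotic_measure T A"
    by (rule LIMSEQ_le_const[OF asymptotic_measure_LIMSEQ[OF T b A]]) simp
  let ?K = "2 * b / (b - 1)" and ?u = "\<lambda>x. indicator {..<1} x / 1 :: real"
  have "1 \<le> ?K" using b by (simp add: field_simps)
  then have u: "dec_density ?K ?u"
    using dec_density_interval[of 1] by (auto intro: dec_density_mono)
  show "asymptotic_measure T A \<le> ?K * measure unit_lborel A"
  proof (rule LIMSEQ_le_const2[OF asymptotic_measure_LIMSEQ[OF T b A]], intro exI allI impI)
    fix n
    obtain g where g: "dec_density ?K g"
        "(\<integral>x. g x * indicator A x \<partial>unit_lborel) = (\<integral>x. ?u x * indicator A ((T ^^ n) x) \<partial>unit_lborel)"
        by (rule transfers_push[OF T order_refl u, of n]) (use A in blast)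
    show "measure unit_lborel ((T ^^ n) -` A \<inter> space unit_lborel) \<le> ?K * measure unit_lborel A"
      unfolding measure_vimage_eq_integral[OF T A] g(2)[symmetric]
      by (rule dec_density_indicator_integral(3)[OF g(1) A])
  qed
qed

text \<open>Stated for signed functions, unlike \<open>dec_density\<close>, so that it is linear in
  \<open>f\<close> and closed under L1 limits. Integrability is carried along for these closure
  steps.\<close>

definition equidistributes :: "(real \<Rightarrow> real) \<Rightarrow> real set \<Rightarrow> (real \<Rightarrow> real) \<Rightarrow> bool" where
  "equidistributes T A f \<longleftrightarrow> integrable unit_lborel f \<and>
     (\<lambda>n. \<integral>x. f x * indicator A ((T ^^ n) x) \<partial>unit_lborel) \<longlonglongrightarrow>
       asymptotic_measure T A * (\<integral>x. f x \<partial>unit_lborel)"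

lemma integrable_mult_funpow_indicator:
  assumes T: "transfers b T B" and A: "A \<in> sets unit_lborel" and f: "integrable unit_lborel f"
  shows "integrable unit_lborel (\<lambda>x. f x * indicator A ((T ^^ n) x) :: real)"
proof (rule Bochner_Integration.integrable_bound[OF f])
  have "(\<lambda>x. indicator A ((T ^^ n) x) :: real) \<in> borel_measurable unit_lborel"
    using transfers_funpow_measurable[OF T] borel_measurable_indicator[OF A] by (rule measurable_compose)
  then show "(\<lambda>x. f x * indicator A ((T ^^ n) x)) \<in> borel_measurable unit_lborel"
    by (intro borel_measurable_times borel_measurable_integrable[OF f])
qed (simp add: indicator_def)

lemma equidistributes_lincomb:
  assumes T: "transfers b T B" and A: "A \<in> sets unit_lborel"
    and f: "equidistributes T A f" and g: "equidistributes T A g"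
  shows "equidistributes T A (\<lambda>x. c * f x + d * g x)"
proof -
  have fi: "integrable unit_lborel f" and gi: "integrable unit_lborel g"
    using f g by (auto simp: equidistributes_def)
  have "(\<integral>x. (c * f x + d * g x) * indicator A ((T ^^ n) x) \<partial>unit_lborel) =
      c * (\<integral>x. f x * indicator A ((T ^^ n) x) \<partial>unit_lborel) +
      d * (\<integral>x. g x * indicator A ((T ^^ n) x) \<partial>unit_lborel)" for n
  proof -
    have "(\<integral>x. (c * f x + d * g x) * indicator A ((T ^^ n) x) \<partial>unit_lborel) =
       (\<integral>x. c * (f x * indicator A ((T ^^ n) x)) + d * (g x * indicator A ((T ^^ n) x)) \<partial>unit_lborel)"
      by (simp only: distrib_right mult.assoc)
    also have "\<dots> = (\<integral>x. c * (f x * indicator A ((T ^^ n) x)) \<partial>unit_lborel) +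
       (\<integral>x. d * (g x * indicator A ((T ^^ n) x)) \<partial>unit_lborel)"
      by (intro Bochner_Integration.integral_add integrable_mult_right
          integrable_mult_funpow_indicator[OF T A] fi gi)
    finally show ?thesis by (simp only: integral_mult_right_zero)
  qed
  moreover have "(\<integral>x. c * f x + d * g x \<partial>unit_lborel) =
      c * (\<integral>x. f x \<partial>unit_lborel) + d * (\<integral>x. g x \<partial>unit_lborel)"
    by (simp only: Bochner_Integration.integral_add[OF integrable_mult_right[OF fi] integrable_mult_right[OF gi]]
        integral_mult_right_zero)
  moreover have "(\<lambda>n. c * (\<integral>x. f x * indicator A ((T ^^ n) x) \<partial>unit_lborel) +
      d * (\<integral>x. g x * indicator A ((T ^^ n) x) \<partial>unit_lborel)) \<longlonglongrightarrow>
      c * (asymptotic_measure T A * (\<integral>x. f x \<partial>unit_lborel)) +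
      d * (asymptotic_measure T A * (\<integral>x. g x \<partial>unit_lborel))"
    using f g by (intro tendsto_intros) (auto simp: equidistributes_def)
  ultimately show ?thesis
    unfolding equidistributes_def using fi gi by (simp add: algebra_simps)
qed

text \<open>Replacing \<open>f\<close> by \<open>s k\<close> changes the integrals by at most the L1
  distance, uniformly in \<open>n\<close> because indicators are at most 1. It changes the claimed
  limit by at most \<open>\<bar>asymptotic_measure T A\<bar>\<close> times that distance.\<close>

lemma equidistributes_L1_limit:
  assumes T: "transfers b T B" and A: "A \<in> sets unit_lborel"
    and s: "\<And>k. equidistributes T A (s k)" and f: "integrable unit_lborel f"
    and lim: "(\<lambda>k. \<integral>x. \<bar>s k x - f x\<bar> \<partial>unit_lborel) \<longlonglongrightarrow> 0"
  shows "equidistributes T A f"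
  unfolding equidistributes_def
proof (intro conjI f LIMSEQ_I)
  fix d :: real assume "0 < d"
  \<comment> \<open>\<open>?M\<close> adds up three errors: two of size \<open>d / ?M\<close> and
    one of size \<open>\<bar>?h\<bar> * (d / ?M)\<close>.\<close>
  let ?h = "asymptotic_measure T A" and ?M = "2 + \<bar>asymptotic_measure T A\<bar>"
  let ?I = "\<lambda>g n. \<integral>x. g x * indicator A ((T ^^ n) x) \<partial>unit_lborel :: real"
  have "0 < d / ?M" using \<open>0 < d\<close> by simp
  from LIMSEQ_D[OF lim this] obtain k where k: "\<bar>\<integral>x. \<bar>s k x - f x\<bar> \<partial>unit_lborel\<bar> < d / ?M"
    by force
  let ?e = "\<integral>x. \<bar>s k x - f x\<bar> \<partial>unit_lborel"
  have si: "integrable unit_lborel (s k)" using s by (simp add: equidistributes_def)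
  have di: "integrable unit_lborel (\<lambda>x. s k x - f x)"
    by (intro Bochner_Integration.integrable_diff si f)
  have near: "\<bar>?I (s k) n - ?I f n\<bar> \<le> ?e" for n
  proof -
    have "?I (s k) n - ?I f n = (\<integral>x. (s k x - f x) * indicator A ((T ^^ n) x) \<partial>unit_lborel)"
      unfolding left_diff_distrib
      by (rule Bochner_Integration.integral_diff[symmetric])
        (intro integrable_mult_funpow_indicator[OF T A] si f)+
    also have "\<bar>\<dots>\<bar> \<le> (\<integral>x. \<bar>(s k x - f x) * indicator A ((T ^^ n) x)\<bar> \<partial>unit_lborel)"
      by (rule integral_abs_bound)
    also have "\<dots> \<le> ?e"
      by (intro integral_mono integrable_abs integrable_mult_funpow_indicator[OF T A] di)
        (simp add: indicator_def)
    finally show ?thesis .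
  qed
  have "(\<integral>x. s k x \<partial>unit_lborel) - (\<integral>x. f x \<partial>unit_lborel) = (\<integral>x. s k x - f x \<partial>unit_lborel)"
    by (rule Bochner_Integration.integral_diff[OF si f, symmetric])
  then have near': "\<bar>(\<integral>x. s k x \<partial>unit_lborel) - (\<integral>x. f x \<partial>unit_lborel)\<bar> \<le> ?e"
    using integral_abs_bound[of unit_lborel "\<lambda>x. s k x - f x"] by simp
  have "(\<lambda>n. ?I (s k) n) \<longlonglongrightarrow> ?h * (\<integral>x. s k x \<partial>unit_lborel)"
    using s by (simp add: equidistributes_def)
  from LIMSEQ_D[OF this \<open>0 < d / ?M\<close>] obtain n0 where
    n0: "\<And>n. n0 \<le> n \<Longrightarrow> \<bar>?I (s k) n - ?h * (\<integral>x. s k x \<partial>unit_lborel)\<bar> < d / ?M" by auto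
  show "\<exists>n0. \<forall>n\<ge>n0. norm (?I f n - ?h * (\<integral>x. f x \<partial>unit_lborel)) < d"
  proof (intro exI allI impI)
    fix n assume "n0 \<le> n"
    have e: "?e < d / ?M" using k by linarith
    have "\<bar>?h * (\<integral>x. s k x \<partial>unit_lborel) - ?h * (\<integral>x. f x \<partial>unit_lborel)\<bar> \<le> \<bar>?h\<bar> * ?e"
      unfolding right_diff_distrib[symmetric] abs_mult using near' by (intro mult_left_mono) auto
    also have "\<dots> \<le> \<bar>?h\<bar> * (d / ?M)" using e by (intro mult_left_mono) auto
    finally have "\<bar>?I f n - ?h * (\<integral>x. f x \<partial>unit_lborel)\<bar> < d / ?M + d / ?M + \<bar>?h\<bar> * (d / ?M)"
      using near[of n] n0[OF \<open>n0 \<le> n\<close>] e by linarith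
    also have "\<dots> = ?M * (d / ?M)" by (simp only: distrib_right)
    also have "\<dots> = d" by simp
    finally show "norm (?I f n - ?h * (\<integral>x. f x \<partial>unit_lborel)) < d" by simp
  qed
qed

lemma indicator_diff_L1_limit:
  assumes C: "\<And>k. C k \<in> sets unit_lborel" and D: "D \<in> sets unit_lborel"
    and lim: "\<And>x. x \<in> space unit_lborel \<Longrightarrow> (\<lambda>k. indicator (C k) x :: real) \<longlonglongrightarrow> indicator D x"
  shows "(\<lambda>k. \<integral>x. \<bar>indicator (C k) x - indicator D x\<bar> \<partial>unit_lborel :: real) \<longlonglongrightarrow> 0"
proof -
  have "(\<lambda>k. \<integral>x. \<bar>indicator (C k) x - indicator D x\<bar> \<partial>unit_lborel :: real) \<longlonglongrightarrow>
      (\<integral>x. 0 \<partial>unit_lborel)"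
  proof (rule integral_dominated_convergence[where w = "\<lambda>_. 2"])
    show "(\<lambda>x. \<bar>indicator (C k) x - indicator D x\<bar> :: real) \<in> borel_measurable unit_lborel" for k
      by (intro borel_measurable_abs borel_measurable_diff borel_measurable_indicator C D)
    show "AE x in unit_lborel. (\<lambda>k. \<bar>indicator (C k) x - indicator D x\<bar> :: real) \<longlonglongrightarrow> 0"
    proof (rule AE_I2)
      fix x assume "x \<in> space unit_lborel"
      from tendsto_rabs[OF tendsto_diff[OF lim[OF this] tendsto_const]]
      show "(\<lambda>k. \<bar>indicator (C k) x - indicator D x\<bar> :: real) \<longlonglongrightarrow> 0"
        by (metis diff_self abs_zero)
    qed
    show "integrable unit_lborel (\<lambda>_. 2 :: real)"
      by (rule integrable_bounded_unit[where C = 2]) simp_all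
    show "AE x in unit_lborel. norm \<bar>indicator (C k) x - indicator D x :: real\<bar> \<le> 2" for k
      by (rule AE_I2) (simp add: indicator_def)
  qed simp
  then show ?thesis by simp
qed

lemma integrable_indicator_unit:
  "D \<in> sets unit_lborel \<Longrightarrow> integrable unit_lborel (indicator D :: real \<Rightarrow> real)"
  by (rule integrable_bounded_unit[where C = 1]) (auto simp: indicator_def)

lemma Int_borel_in_sets_unit_lborel: "D \<in> sets borel \<Longrightarrow> {0..<1} \<inter> D \<in> sets unit_lborel"
  by (simp add: sets_restrict_space_iff)

lemma equidistributes_cong:
  assumes eq: "\<And>x. x \<in> space unit_lborel \<Longrightarrow> f x = g x" and f: "equidistributes T A f"
  shows "equidistributes T A g"
proof -
  have "integrable unit_lborel f = integrable unit_lborel g"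
    by (rule Bochner_Integration.integrable_cong[OF refl eq])
  moreover have "(\<integral>x. f x \<partial>unit_lborel) = (\<integral>x. g x \<partial>unit_lborel)"
    by (rule Bochner_Integration.integral_cong[OF refl eq])
  moreover have "(\<integral>x. f x * indicator A ((T ^^ n) x) \<partial>unit_lborel) =
      (\<integral>x. g x * indicator A ((T ^^ n) x) \<partial>unit_lborel)" for n
    by (rule Bochner_Integration.integral_cong[OF refl]) (simp only: eq)
  ultimately show ?thesis using f by (simp only: equidistributes_def)
qed

text \<open>Scaled to integral 1, the indicator of a nonempty interval that starts at 0 is a
  nonincreasing density.\<close>

lemma equidistributes_interval:
  assumes T: "transfers b T B" and b: "1 < b" and A: "A \<in> sets unit_lborel"
  shows "equidistributes T A (indicator ({0..<1} \<inter> {..<a}))"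
proof (cases "0 < a")
  case True
  define c where "c = min a 1"
  have c: "0 < c" "c \<le> 1" using True by (auto simp: c_def)
  have f: "dec_density (1 / c) (\<lambda>x. indicator {..<c} x / c)" by (rule dec_density_interval[OF c])
  have fe: "equidistributes T A (\<lambda>x. indicator {..<c} x / c)"
    unfolding equidistributes_def
    using asymptotic_measure_dec_density[OF T b A f] dec_densityD(5)[OF f]
      dec_density_integrable[OF f, of "\<lambda>_. 1" 1] by simp
  have "equidistributes T A (\<lambda>x. c * (indicator {..<c} x / c) + 0 * (indicator {..<c} x / c))"
    by (rule equidistributes_lincomb[OF T A fe fe])
  then show ?thesis
    by (rule equidistributes_cong[rotated]) (use c in \<open>auto simp: space_unit_lborel c_def indicator_def\<close>)
next
  case False
  then have "{0..<1} \<inter> {..<a} = {}" by auto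
  then show ?thesis by (simp only:) (simp add: equidistributes_def)
qed

text \<open>Dynkin's argument with the half lines \<open>{..<a}\<close> as intersection-stable
  generator; intersecting with \<open>[0, 1)\<close> in the claim allows the generator to live on
  the whole line. Countable disjoint unions are L1 limits of finite ones.\<close>

lemma equidistributes_indicator:
  assumes T: "transfers b T B" and b: "1 < b" and A: "A \<in> sets unit_lborel"
    and D: "D \<in> sets borel"
  shows "equidistributes T A (indicator ({0..<1} \<inter> D))"
proof -
  have sets_eq: "sets borel = sigma_sets UNIV (range lessThan :: real set set)"
    by (subst borel_Iio) (rule sets_measure_of, simp)
  have "Int_stable (range lessThan :: real set set)"
  proof (clarsimp simp: Int_stable_def)
    fix a c :: real
    have "{..<a} \<inter> {..<c} = {..<min a c}" by auto
    then show "{..<a} \<inter> {..<c} \<in> range lessThan" by blast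
  qed
  moreover have "range lessThan \<subseteq> Pow (UNIV :: real set)" by simp
  moreover have "D \<in> sigma_sets UNIV (range lessThan)"
    using D by (simp only: sets_eq)
  ultimately show ?thesis
  proof (induction D rule: sigma_sets_induct_disjoint)
    case (basic D)
    then show ?case using equidistributes_interval[OF T b A] by auto
  next
    case empty
    then show ?case by (simp add: equidistributes_def)
  next
    case (compl D)
    have "equidistributes T A (indicator ({0..<1} \<inter> {..<1}))"
      by (rule equidistributes_interval[OF T b A])
    \<comment> \<open>Relative to \<open>[0, 1)\<close>, the complement is a difference of two
      indicators.\<close>
    from equidistributes_lincomb[OF T A this compl.IH, of 1 "-1"]
    have "equidistributes T A
      (\<lambda>x. 1 * indicator ({0..<1} \<inter> {..<1}) x + - 1 * indicator ({0..<1} \<inter> D) x)" .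
    also have "(\<lambda>x. 1 * indicator ({0..<1} \<inter> {..<1}) x + - 1 * indicator ({0..<1} \<inter> D) x) =
      (indicator ({0..<1} \<inter> (UNIV - D)) :: real \<Rightarrow> real)"
      by (auto simp: indicator_def)
    finally show ?case .
  next
    case (union D)
    have Db: "D i \<in> sets borel" for i
      using union.hyps(2) by (auto simp only: sets_eq)
    define C where "C k = {0..<1} \<inter> (\<Union>i<k. D i)" for k :: nat
    have C: "C k \<in> sets unit_lborel" for k
      unfolding C_def using Db by (intro Int_borel_in_sets_unit_lborel sets.finite_UN) auto
    have U: "{0..<1} \<inter> (\<Union>i. D i) \<in> sets unit_lborel"
      using Db by (intro Int_borel_in_sets_unit_lborel sets.countable_UN) auto
    have Ce: "equidistributes T A (indicator (C k))" for k
    proof (induction k)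
      case 0
      then show ?case by (simp add: equidistributes_def C_def)
    next
      case (Suc k)
      have "D k \<inter> D i = {}" if "i < k" for i
        using union.hyps(1) that by (simp add: disjoint_family_on_def)
      then have "D k \<inter> (\<Union>i<k. D i) = {}" by blast
      then have "(\<lambda>x. 1 * indicator (C k) x + 1 * indicator ({0..<1} \<inter> D k) x) =
         (indicator (C (Suc k)) :: real \<Rightarrow> real)"
        by (auto simp: indicator_def C_def lessThan_Suc fun_eq_iff)
      then show ?case using equidistributes_lincomb[OF T A Suc union.IH[of k], of 1 1] by (simp only:)
    qed
    show ?case
    proof (rule equidistributes_L1_limit[OF T A Ce integrable_indicator_unit[OF U]])
      show "(\<lambda>k. \<integral>x. \<bar>indicator (C k) x - indicator ({0..<1} \<inter> (\<Union>i. D i)) x\<bar> \<partial>unit_lborel :: real) \<longlonglongrightarrow> 0"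
      proof (rule indicator_diff_L1_limit[OF C U])
        show "(\<lambda>k. indicator (C k) x :: real) \<longlonglongrightarrow> indicator ({0..<1} \<inter> (\<Union>i. D i)) x" for x
        proof (cases "x \<in> {0..<1} \<inter> (\<Union>i. D i)")
          case True
          then obtain i where "x \<in> {0..<1}" "x \<in> D i" by auto
          then have "x \<in> C k" if "Suc i \<le> k" for k
            using that by (auto simp: C_def)
          then have "eventually (\<lambda>k. indicator (C k) x = (1::real)) sequentially"
            unfolding eventually_sequentially by (metis indicator_simps(1))
          then show ?thesis using True by (simp add: tendsto_eventually)
        next
          case False
          then have "indicator (C k) x = (0::real)" for k by (auto simp: C_def)
          then show ?thesis using False by simp
        qed
      qed
    qed
  qed
qed

lemma equidistributes_integrable:
  assumes T: "transfers b T B" and b: "1 < b" and A: "A \<in> sets unit_lborel"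
    and f: "integrable unit_lborel f"
  shows "equidistributes T A f"
  using f
proof (induction f rule: integrable_induct)
  case (base D c)
  have "{0..<1} \<inter> D = D" "D \<in> sets borel"
    using base sets.sets_into_space[OF base(1)] by (auto simp: space_unit_lborel sets_restrict_space_iff)
  with equidistributes_indicator[OF T b A, of D] have D: "equidistributes T A (indicator D)" by simp
  from equidistributes_lincomb[OF T A D D, of c 0] show ?case by (simp add: mult.commute)
next
  case (add f g)
  from equidistributes_lincomb[OF T A add.IH, of 1 1] show ?case by simp
next
  case (lim f s)
  show ?case
  proof (rule equidistributes_L1_limit[OF T A lim.IH lim.hyps(4)])
    have fm: "f \<in> borel_measurable unit_lborel" "\<And>k. s k \<in> borel_measurable unit_lborel"
      using lim.hyps(1,4) by (auto simp del: measurable_lborel1)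
    have "(\<lambda>k. \<integral>x. \<bar>s k x - f x\<bar> \<partial>unit_lborel) \<longlonglongrightarrow> (\<integral>x. 0 \<partial>unit_lborel)"
    \<comment> \<open>The approximating sequence satisfies
      \<open>\<bar>s k x\<bar> \<le> 2 * \<bar>f x\<bar>\<close>, hence the factor 3.\<close>
    proof (rule integral_dominated_convergence[where w = "\<lambda>x. 3 * \<bar>f x\<bar>"])
      show "(\<lambda>x. \<bar>s k x - f x\<bar>) \<in> borel_measurable unit_lborel" for k
        by (intro borel_measurable_abs borel_measurable_diff fm)
      show "integrable unit_lborel (\<lambda>x. 3 * \<bar>f x\<bar>)"
        by (intro integrable_mult_right integrable_abs lim.hyps(4))
      show "AE x in unit_lborel. (\<lambda>k. \<bar>s k x - f x\<bar>) \<longlonglongrightarrow> 0"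
      proof (rule AE_I2)
        fix x assume "x \<in> space unit_lborel"
        from tendsto_rabs[OF tendsto_diff[OF lim.hyps(2)[OF this] tendsto_const]]
        show "(\<lambda>k. \<bar>s k x - f x\<bar>) \<longlonglongrightarrow> 0" by (metis diff_self abs_zero)
      qed
      show "AE x in unit_lborel. norm \<bar>s k x - f x\<bar> \<le> 3 * \<bar>f x\<bar>" for k
      proof (rule AE_I2)
        fix x assume "x \<in> space unit_lborel"
        from lim.hyps(3)[OF this, of k] show "norm \<bar>s k x - f x\<bar> \<le> 3 * \<bar>f x\<bar>" by simp
      qed
    qed simp
    then show "(\<lambda>k. \<integral>x. \<bar>s k x - f x\<bar> \<partial>unit_lborel) \<longlonglongrightarrow> 0" by simp
  qed
qed

section \<open>Uniqueness and existence of absolutely continuous invariant measures\<close>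

lemma preserves_measure_funpow:
  assumes "preserves_measure M T" and "A \<in> sets M"
  shows "(T ^^ n) -` A \<inter> space M \<in> sets M \<and> emeasure M ((T ^^ n) -` A \<inter> space M) = emeasure M A"
proof (induction n)
  case 0
  then show ?case using assms(2) sets.sets_into_space[OF assms(2)] by (simp add: Int_absorb2)
next
  case (Suc n)
  have T: "T \<in> measurable M M" using assms by (simp add: preserves_measure_def)
  have "(T ^^ Suc n) -` A \<inter> space M = T -` ((T ^^ n) -` A \<inter> space M) \<inter> space M"
    using measurable_space[OF T] by (auto simp: funpow_Suc_right simp del: funpow.simps)
  then show ?case
    using Suc assms(1) measurable_sets[OF T] by (simp only: preserves_measure_def)
qed

text \<open>Detaches \<open>acip\<close> from alternate bases; \<open>acip_iff_is_acip\<close> links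
  the two.\<close>

definition is_acip :: "(real \<Rightarrow> real) \<Rightarrow> real measure \<Rightarrow> bool" where
  "is_acip T M \<longleftrightarrow> sets M = sets unit_lborel \<and> prob_space M \<and>
     absolutely_continuous unit_lborel M \<and> preserves_measure M T"

text \<open>For a density \<open>g\<close> of \<open>M\<close>, the integrals of \<open>g\<close>
  over the iterated preimages of \<open>A\<close> are constant by invariance and converge to
  \<open>asymptotic_measure T A\<close> by equidistribution. This is the uniqueness
  argument.\<close>

lemma is_acip_emeasure:
  assumes T: "transfers b T B" and b: "1 < b" and M: "is_acip T M" and A: "A \<in> sets unit_lborel"
  shows "emeasure M A = ennreal (asymptotic_measure T A)"
proof -
  have sets: "sets M = sets unit_lborel" and inv: "preserves_measure M T"
    and ac: "absolutely_continuous unit_lborel M" and "prob_space M"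
    using M by (auto simp: is_acip_def)
  interpret M: prob_space M by fact
  interpret U: prob_space unit_lborel by (rule prob_space_unit_lborel)
  have space: "space M = space unit_lborel" using sets by (rule sets_eq_imp_space_eq)
  from U.Radon_Nikodym[OF ac sets] obtain f where
    f: "f \<in> borel_measurable unit_lborel" "density unit_lborel f = M" by blast
  \<comment> \<open>The Radon-Nikodym density takes extended values; its integral is 1, so it is
    finite almost everywhere and agrees there with the real function \<open>g\<close>.\<close>
  define g where "g x = enn2real (f x)" for x
  have gm: "g \<in> borel_measurable unit_lborel"
    unfolding g_def using f(1) by (rule borel_measurable_enn2real)
  have f1: "(\<integral>\<^sup>+x. f x \<partial>unit_lborel) = 1"
  proof -
    have "(\<integral>\<^sup>+x. f x \<partial>unit_lborel) = (\<integral>\<^sup>+x. f x * indicator (space unit_lborel) x \<partial>unit_lborel)"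
      by (rule nn_integral_cong) simp
    also have "\<dots> = emeasure (density unit_lborel f) (space unit_lborel)"
      by (rule emeasure_density[OF f(1) sets.top, symmetric])
    also have "\<dots> = 1" unfolding f(2) space[symmetric] by (rule M.emeasure_space_1)
    finally show ?thesis .
  qed
  then have "AE x in unit_lborel. f x \<noteq> \<infinity>"
    by (intro nn_integral_noteq_infinite f) simp
  then have fg: "AE x in unit_lborel. f x = ennreal (g x)"
    by (rule AE_mp) (auto intro!: AE_I2 simp: g_def less_top)
  have Mg: "M = density unit_lborel (\<lambda>x. ennreal (g x))"
    unfolding f(2)[symmetric] using f(1) gm fg by (intro density_cong) auto
  have g1: "(\<integral>\<^sup>+x. ennreal (g x) \<partial>unit_lborel) = 1"
    using f1 nn_integral_cong_AE[OF fg] by simp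
  have gi: "integrable unit_lborel g"
    unfolding integrable_iff_bounded using gm g1 by (simp add: g_def)
  have "(\<integral>x. g x \<partial>unit_lborel) = 1"
    by (subst integral_eq_nn_integral[OF gm]) (simp_all only: g1, simp_all add: g_def)
  with equidistributes_integrable[OF T b A gi]
  have lim: "(\<lambda>n. \<integral>x. g x * indicator A ((T ^^ n) x) \<partial>unit_lborel) \<longlonglongrightarrow> asymptotic_measure T A"
    by (simp add: equidistributes_def)
  have "(\<integral>x. g x * indicator A ((T ^^ n) x) \<partial>unit_lborel) = measure M A" for n
  proof -
    let ?A = "(T ^^ n) -` A \<inter> space unit_lborel"
    have A': "?A \<in> sets unit_lborel" by (rule transfers_vimage[OF T A])
    have "(\<integral>x. g x * indicator A ((T ^^ n) x) \<partial>unit_lborel) = (\<integral>x. g x *\<^sub>R indicator ?A x \<partial>unit_lborel)"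
      unfolding real_scaleR_def by (rule integral_vimage_unit[symmetric])
    also have "\<dots> = (\<integral>x. indicator ?A x \<partial>density unit_lborel (\<lambda>x. ennreal (g x)))"
      by (intro integral_density[symmetric] gm borel_measurable_indicator A') (simp add: g_def)
    also have "\<dots> = measure M ?A"
      unfolding Mg[symmetric] using A' sets by (simp add: space[symmetric])
    also have "\<dots> = measure M A"
      using preserves_measure_funpow[OF inv, of A n] A sets
      unfolding measure_def space[symmetric] by simp
    finally show ?thesis .
  qed
  with lim have "(\<lambda>n. measure M A) \<longlonglongrightarrow> asymptotic_measure T A" by simp
  then have "measure M A = asymptotic_measure T A" by (simp add: LIMSEQ_const_iff)
  then show ?thesis by (simp add: M.emeasure_eq_measure)
qed

lemma asymptotic_measure_additive:
  assumes T: "transfers b T B" and b: "1 < b" and A: "A \<in> sets unit_lborel" and C: "C \<in> sets unit_lborel"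
    and disj: "A \<inter> C = {}"
  shows "asymptotic_measure T (A \<union> C) = asymptotic_measure T A + asymptotic_measure T C"
proof -
  interpret U: prob_space unit_lborel by (rule prob_space_unit_lborel)
  have "measure unit_lborel ((T ^^ n) -` (A \<union> C) \<inter> space unit_lborel) =
    measure unit_lborel ((T ^^ n) -` A \<inter> space unit_lborel) +
    measure unit_lborel ((T ^^ n) -` C \<inter> space unit_lborel)" for n
    unfolding vimage_Un Int_Un_distrib2 using disj
    by (intro U.finite_measure_Union transfers_vimage[OF T] A C) auto
  then have "(\<lambda>n. measure unit_lborel ((T ^^ n) -` (A \<union> C) \<inter> space unit_lborel))
    \<longlonglongrightarrow> asymptotic_measure T A + asymptotic_measure T C"
    using tendsto_add[OF asymptotic_measure_LIMSEQ[OF T b A] asymptotic_measure_LIMSEQ[OF T b C]]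
    by simp
  with asymptotic_measure_LIMSEQ[OF T b sets.Un[OF A C]] show ?thesis by (rule LIMSEQ_unique)
qed

text \<open>The witness is the measure with values \<open>asymptotic_measure T A\<close>; its
  domination by a multiple of Lebesgue measure supplies what the limit process alone does
  not.\<close>

lemma ex_is_acip:
  assumes T: "transfers b T B" and b: "1 < b"
  shows "\<exists>M. is_acip T M"
proof -
  interpret U: prob_space unit_lborel by (rule prob_space_unit_lborel)
  let ?h = "\<lambda>A. ennreal (asymptotic_measure T A)"
  define M where "M = measure_of (space unit_lborel) (sets unit_lborel) ?h"
  note le = asymptotic_measure_le[OF T b]
  have h0: "asymptotic_measure T {} = 0"
    using le[of "{}"] by simp
  \<comment> \<open>The limit is at first only finitely additive. Domination by a multiple of
    Lebesgue measure gives continuity at the empty set, and with it countable additivity.\<close>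
  have ca: "countably_additive (sets unit_lborel) ?h"
  proof (rule sets.empty_continuous_imp_countably_additive)
    show "positive (sets unit_lborel) ?h" using h0 by (simp add: positive_def)
    show "additive (sets unit_lborel) ?h"
      unfolding additive_def
      by (intro ballI impI) (simp add: asymptotic_measure_additive[OF T b] le ennreal_plus)
    show "\<forall>A\<in>sets unit_lborel. ?h A \<noteq> \<infinity>" by simp
    fix A :: "nat \<Rightarrow> real set"
    assume A: "range A \<subseteq> sets unit_lborel" "decseq A" "(\<Inter>i. A i) = {}"
    then have Ai: "A i \<in> sets unit_lborel" for i by auto
    have "(\<lambda>i. measure unit_lborel (A i)) \<longlonglongrightarrow> measure unit_lborel (\<Inter>i. A i)"
      by (rule U.finite_Lim_measure_decseq[OF A(1,2)])
    then have "(\<lambda>i. 2 * b / (b - 1) * measure unit_lborel (A i)) \<longlonglongrightarrow> 2 * b / (b - 1) * 0"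
      unfolding A(3) by (intro tendsto_mult_left) simp
    then have up: "(\<lambda>i. 2 * b / (b - 1) * measure unit_lborel (A i)) \<longlonglongrightarrow> 0"
      by (simp only: mult_zero_right)
    have "(\<lambda>i. asymptotic_measure T (A i)) \<longlonglongrightarrow> 0"
      by (rule tendsto_sandwich[OF always_eventually always_eventually tendsto_const up])
        (simp_all only: le[OF Ai] simp_thms)
    from tendsto_ennrealI[OF this] show "(\<lambda>i. ?h (A i)) \<longlonglongrightarrow> 0"
      by (simp only: ennreal_0)
  qed
  have sets: "sets M = sets unit_lborel" and space: "space M = space unit_lborel"
    unfolding M_def by (rule sets.sets_measure_of_eq, rule sets.space_measure_of_eq)
  have em: "emeasure M A = ?h A" if "A \<in> sets unit_lborel" for A
    unfolding M_def
    by (rule emeasure_measure_of_sigma[OF sets.sigma_algebra_axioms _ ca that])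
      (simp add: positive_def h0)
  \<comment> \<open>Passing to the preimage shifts the sequence by one index, which leaves its limit
    unchanged.\<close>
  have inv: "asymptotic_measure T (T -` A \<inter> space unit_lborel) = asymptotic_measure T A"
    if A: "A \<in> sets unit_lborel" for A
  proof -
    have A': "T -` A \<inter> space unit_lborel \<in> sets unit_lborel"
      using transfers_vimage[OF T A, of 1] by simp
    have "(\<lambda>n. measure unit_lborel ((T ^^ Suc n) -` A \<inter> space unit_lborel)) \<longlonglongrightarrow> asymptotic_measure T A"
      by (rule LIMSEQ_Suc[OF asymptotic_measure_LIMSEQ[OF T b A]])
    moreover have "(T ^^ Suc n) -` A \<inter> space unit_lborel =
      (T ^^ n) -` (T -` A \<inter> space unit_lborel) \<inter> space unit_lborel" for n
      using funpow_vimage[OF T, of 1 n A] by simp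
    ultimately show ?thesis
      using LIMSEQ_unique[OF asymptotic_measure_LIMSEQ[OF T b A']] by simp
  qed
  have "is_acip T M"
    unfolding is_acip_def
  proof (intro conjI sets)
    have "asymptotic_measure T (space unit_lborel) = 1"
    proof -
      have "(T ^^ n) -` space unit_lborel \<inter> space unit_lborel = space unit_lborel" for n
        using measurable_space[OF transfers_funpow_measurable[OF T]] by auto
      then have "(\<lambda>n. measure unit_lborel (space unit_lborel)) \<longlonglongrightarrow> asymptotic_measure T (space unit_lborel)"
        using asymptotic_measure_LIMSEQ[OF T b sets.top] by (simp only:)
      then show ?thesis by (simp only: LIMSEQ_const_iff U.prob_space)
    qed
    then show "prob_space M"
      by (intro prob_spaceI) (simp only: em[OF sets.top] space ennreal_1)
    show "absolutely_continuous unit_lborel M"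
      unfolding absolutely_continuous_def
    proof
      fix N assume N: "N \<in> null_sets unit_lborel"
      then have "measure unit_lborel N = 0" by (simp add: null_sets_def measure_def)
      then have "asymptotic_measure T N = 0" using le[of N] N by (auto simp: null_sets_def)
      then show "N \<in> null_sets M" using N em[of N] sets by (auto simp: null_sets_def)
    qed
    show "preserves_measure M T"
      unfolding preserves_measure_def
    proof (intro conjI ballI)
      show "T \<in> measurable M M"
        using transfersD(1)[OF T] by (simp only: measurable_cong_sets[OF sets sets])
      fix A assume "A \<in> sets M"
      then have A: "A \<in> sets unit_lborel" by (simp only: sets)
      have A': "T -` A \<inter> space unit_lborel \<in> sets unit_lborel"
        using transfers_vimage[OF T A, of 1] by simp
      show "emeasure M (T -` A \<inter> space M) = emeasure M A"
        unfolding space em[OF A] em[OF A'] inv[OF A] ..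
    qed
  qed
  then show ?thesis ..
qed

lemma is_acip_unique:
  assumes "transfers b T B" and "1 < b" and "is_acip T M" and "is_acip T N"
  shows "M = N"
proof (rule measure_eqI)
  show "sets M = sets N" using assms by (simp add: is_acip_def)
  show "emeasure M A = emeasure N A" if "A \<in> sets M" for A
    using that assms is_acip_emeasure[OF assms(1,2)] by (simp add: is_acip_def)
qed

section \<open>Invariant measures of alternate bases\<close>

text \<open>Absolute continuity survives because \<open>S\<close> pulls null sets back to null sets,
  and invariance follows from the semiconjugacy. Combined with uniqueness, this identifies
  consecutive fibre measures.\<close>

lemma is_acip_distr:
  assumes S: "transfers b S C" and "1 < b" and M: "is_acip T M"
    and T': "T' \<in> measurable unit_lborel unit_lborel"
    and comm: "\<And>x. T' (S x) = S (T x)"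
  shows "is_acip T' (distr M unit_lborel S)"
proof -
  have sets: "sets M = sets unit_lborel" and inv: "preserves_measure M T"
    and ac: "absolutely_continuous unit_lborel M" and "prob_space M"
    using M by (auto simp: is_acip_def)
  interpret M: prob_space M by fact
  have space: "space M = space unit_lborel" using sets by (rule sets_eq_imp_space_eq)
  have S1: "S \<in> measurable unit_lborel unit_lborel" by (rule transfersD(1)[OF S])
  have SM: "S \<in> measurable M unit_lborel" using S1 by (simp only: measurable_cong_sets[OF sets refl])
  have TM: "T \<in> measurable M M" using inv by (simp add: preserves_measure_def)
  show ?thesis
    unfolding is_acip_def
  proof (intro conjI)
    show "sets (distr M unit_lborel S) = sets unit_lborel" by simp
    show "prob_space (distr M unit_lborel S)" by (rule M.prob_space_distr[OF SM])
    show "absolutely_continuous unit_lborel (distr M unit_lborel S)"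
      unfolding absolutely_continuous_def
    proof
      fix N assume N: "N \<in> null_sets unit_lborel"
      then have N': "N \<in> sets unit_lborel" "measure unit_lborel N = 0"
        by (auto simp: null_sets_def measure_def)
      let ?K = "2 * b / (b - 1)" and ?u = "\<lambda>x. indicator {..<1} x / 1 :: real"
      have "1 \<le> ?K" using \<open>1 < b\<close> by (simp add: field_simps)
      then have u: "dec_density ?K ?u"
        using dec_density_interval[of 1] by (auto intro: dec_density_mono)
      \<comment> \<open>The push of the uniform density by \<open>S\<close> is bounded by
        \<open>?K\<close>, so the preimage of \<open>N\<close> has measure at most \<open>?K\<close>
        times that of \<open>N\<close>, which is 0.\<close>
      obtain g where g: "dec_density ?K g"
        "(\<integral>x. g x * indicator N x \<partial>unit_lborel) = (\<integral>x. ?u x * indicator N ((S ^^ 1) x) \<partial>unit_lborel)"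
        by (rule transfers_push[OF S order_refl u, of 1]) (use N' in blast)
      have "measure unit_lborel ((S ^^ 1) -` N \<inter> space unit_lborel) = (\<integral>x. g x * indicator N x \<partial>unit_lborel)"
        unfolding g(2) by (rule measure_vimage_eq_integral[OF S N'(1)])
      also have "\<dots> \<le> ?K * measure unit_lborel N"
        by (rule dec_density_indicator_integral[OF g(1) N'(1)])
      finally have "measure unit_lborel (S -` N \<inter> space unit_lborel) \<le> 0"
        by (simp add: N')
      then have "measure unit_lborel (S -` N \<inter> space unit_lborel) = 0"
        using measure_nonneg by (rule antisym)
      moreover have "S -` N \<inter> space unit_lborel \<in> sets unit_lborel"
        using S1 N'(1) by (rule measurable_sets)
      ultimately have "S -` N \<inter> space unit_lborel \<in> null_sets unit_lborel"
        by (intro null_setsI) (simp_all only: finite_measure.emeasure_eq_measure[OF prob_space.finite_measure[OF prob_space_unit_lborel]] ennreal_0)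
      then have "S -` N \<inter> space unit_lborel \<in> null_sets M"
        using ac by (auto simp: absolutely_continuous_def)
      then show "N \<in> null_sets (distr M unit_lborel S)"
        using N' unfolding null_sets_distr_iff[OF SM] space by simp
    qed
    show "preserves_measure (distr M unit_lborel S) T'"
      unfolding preserves_measure_def
    proof (intro conjI ballI)
      show "T' \<in> measurable (distr M unit_lborel S) (distr M unit_lborel S)"
        using T' by (simp only: measurable_distr_eq1 measurable_distr_eq2)
      fix A assume "A \<in> sets (distr M unit_lborel S)"
      then have A: "A \<in> sets unit_lborel" by simp
      have A': "T' -` A \<inter> space unit_lborel \<in> sets unit_lborel"
        using T' A by (rule measurable_sets)
      have A'': "S -` A \<inter> space M \<in> sets M" using SM A by (rule measurable_sets)
      have "emeasure (distr M unit_lborel S) (T' -` A \<inter> space unit_lborel) =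
          emeasure M (S -` (T' -` A \<inter> space unit_lborel) \<inter> space M)"
        by (rule emeasure_distr[OF SM A'])
      also have "S -` (T' -` A \<inter> space unit_lborel) \<inter> space M = T -` (S -` A \<inter> space M) \<inter> space M"
        using measurable_space[OF SM] measurable_space[OF TM] by (auto simp only: comm vimage_def)
      also have "emeasure M \<dots> = emeasure M (S -` A \<inter> space M)"
        using inv A'' by (simp only: preserves_measure_def)
      also have "\<dots> = emeasure (distr M unit_lborel S) A"
        by (rule emeasure_distr[OF SM A, symmetric])
      finally show "emeasure (distr M unit_lborel S) (T' -` A \<inter> space (distr M unit_lborel S)) =
          emeasure (distr M unit_lborel S) A"
        by (simp only: space_distr)
    qed
  qed
qed

section \<open>Return maps and fibre measures\<close>

definition alternate_base :: "real list \<Rightarrow> bool" where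
  "alternate_base bs \<longleftrightarrow> bs \<noteq> [] \<and> (\<forall>\<beta>\<in>set bs. 1 < \<beta>)"

lemma base_at_cong: "m mod int (length bs) = n mod int (length bs) \<Longrightarrow> base_at bs m = base_at bs n"
  by (simp only: base_at_def)

text \<open>\<open>Min (set bs)\<close> serves as the common slope bound \<open>b\<close> of
  \<open>transfers\<close> for all entries, and hence for all return maps.\<close>

lemma alternate_base_ge:
  assumes "alternate_base bs"
  shows "1 < Min (set bs)" "Min (set bs) \<le> base_at bs n" "1 < base_at bs n"
proof -
  show 1: "1 < Min (set bs)" using assms by (simp add: alternate_base_def)
  have "nat (n mod int (length bs)) < length bs"
    using assms by (simp add: alternate_base_def nat_less_iff)
  then show 2: "Min (set bs) \<le> base_at bs n" by (simp add: base_at_def)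
  from 1 2 show "1 < base_at bs n" by simp
qed

text \<open>An empty list would give the identity, which does not expand.\<close>

lemma transfers_foldr:
  assumes "1 < b" and c: "\<And>k. b \<le> c k" and "ks \<noteq> []"
  shows "\<exists>B. transfers b (foldr (\<lambda>k. beta_map (c k)) ks) B"
  using \<open>ks \<noteq> []\<close>
proof (induction ks)
  case (Cons k ks)
  show ?case
  proof (cases "ks = []")
    case True
    have "foldr (\<lambda>k. beta_map (c k)) (k # ks) = beta_map (c k)" by (simp add: True fun_eq_iff)
    then show ?thesis using transfers_beta_map[OF \<open>1 < b\<close> c[of k]] by auto
  next
    case False
    with Cons.IH obtain B where "transfers b (foldr (\<lambda>k. beta_map (c k)) ks) B" by blast
    from transfers_comp[OF transfers_beta_map[OF \<open>1 < b\<close> c[of k]] this]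
    show ?thesis by (auto simp only: foldr.simps)
  qed
qed simp

lemma transfers_return_map:
  assumes "alternate_base bs"
  shows "\<exists>B. transfers (Min (set bs)) (return_map bs i) B"
proof -
  have "[1..<Suc (length bs)] \<noteq> []" using assms by (simp add: alternate_base_def Suc_le_eq)
  from transfers_foldr[OF alternate_base_ge(1)[OF assms] alternate_base_ge(2)[OF assms] this]
  show ?thesis unfolding return_map_def .
qed

text \<open>Both sides compose the \<open>p + 1\<close> beta maps with indices from
  \<open>i - p\<close>, applied first, up to \<open>i\<close>; by periodicity the first and the last
  of them coincide.\<close>

lemma return_map_Suc_beta_map:
  assumes "alternate_base bs"
  shows "return_map bs (Suc i) (beta_map (base_at bs (int i)) x) =
    beta_map (base_at bs (int i)) (return_map bs i x)"
proof -
  define p where "p = length bs"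
  let ?T = "\<lambda>k. beta_map (base_at bs (int i - int k))"
  have upt: "[1..<Suc p] = map Suc [0..<p]" by (simp add: map_Suc_upt)
  have p: "base_at bs (int i - int p) = base_at bs (int i)"
    by (rule base_at_cong) (simp add: p_def)
  have "return_map bs (Suc i) (beta_map (base_at bs (int i)) x) =
      foldr ?T [0..<p] (?T p x)"
    unfolding return_map_def p_def[symmetric] upt foldr_map comp_def by (simp add: p)
  also have "\<dots> = foldr ?T [0..<Suc p] x" by simp
  also have "\<dots> = ?T 0 (foldr ?T [1..<Suc p] x)"
    by (subst upt_conv_Cons) simp_all
  finally show ?thesis by (simp only: return_map_def p_def of_nat_0 diff_0_right)
qed

lemma acip_iff_is_acip: "acip bs i M \<longleftrightarrow> is_acip (return_map bs i) M"
  by (simp only: acip_def is_acip_def sets_unit_lborel)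

text \<open>Existence and uniqueness together make the \<open>THE\<close> in
  \<open>fibre_measure\<close> denote.\<close>

lemma is_acip_fibre_measure:
  assumes bs: "alternate_base bs"
  shows "is_acip (return_map bs i) (fibre_measure bs i)"
proof -
  note b = alternate_base_ge(1)[OF bs]
  obtain B where T: "transfers (Min (set bs)) (return_map bs i) B"
    using transfers_return_map[OF bs] by blast
  obtain M where M: "is_acip (return_map bs i) M" using ex_is_acip[OF T b] by blast
  have "acip bs i (fibre_measure bs i)"
    unfolding fibre_measure_def
    by (rule theI[of "acip bs i" M]) (use M is_acip_unique[OF T b] in \<open>auto simp: acip_iff_is_acip\<close>)
  then show ?thesis by (simp only: acip_iff_is_acip)
qed

lemma sets_fibre_measure: "alternate_base bs \<Longrightarrow> sets (fibre_measure bs i) = sets unit_lborel"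
  by (rule is_acip_fibre_measure[unfolded is_acip_def, THEN conjunct1])

text \<open>The push-forward of one fibre measure is an absolutely continuous invariant probability
  measure for the next return map, so uniqueness identifies it.\<close>

lemma fibre_measure_Suc:
  assumes bs: "alternate_base bs" and A: "A \<in> sets unit_lborel"
  shows "emeasure (fibre_measure bs (Suc i)) A =
    emeasure (fibre_measure bs i) (beta_map (base_at bs (int i)) -` A \<inter> space unit_lborel)"
proof -
  note b = alternate_base_ge(1)[OF bs]
  obtain B where T: "transfers (Min (set bs)) (return_map bs (Suc i)) B"
    using transfers_return_map[OF bs] by blast
  let ?S = "beta_map (base_at bs (int i))"
  have S: "transfers (Min (set bs)) ?S (base_at bs (int i))"
    by (rule transfers_beta_map[OF b alternate_base_ge(2)[OF bs]])
  have "is_acip (return_map bs (Suc i)) (distr (fibre_measure bs i) unit_lborel ?S)"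
    using is_acip_fibre_measure[OF bs] transfersD(1)[OF T]
    by (rule is_acip_distr[OF S b]) (rule return_map_Suc_beta_map[OF bs])
  from is_acip_unique[OF T b is_acip_fibre_measure[OF bs] this]
  have eq: "fibre_measure bs (Suc i) = distr (fibre_measure bs i) unit_lborel ?S" .
  have "?S \<in> measurable (fibre_measure bs i) unit_lborel"
    using transfersD(1)[OF S] by (simp only: measurable_cong_sets[OF sets_fibre_measure[OF bs] refl])
  from emeasure_distr[OF this A] show ?thesis
    unfolding eq sets_eq_imp_space_eq[OF sets_fibre_measure[OF bs]] .
qed

text \<open>The index enters only through \<open>base_at\<close>, which is periodic; this closes the
  cycle of layers.\<close>

lemma fibre_measure_mod: "fibre_measure bs (i mod length bs) = fibre_measure bs i"
proof -
  have "base_at bs (int (i mod length bs) - int k) = base_at bs (int i - int k)" for k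
    by (rule base_at_cong) (simp add: zmod_int mod_diff_left_eq)
  then have "return_map bs (i mod length bs) = return_map bs i"
    by (simp add: return_map_def)
  then show ?thesis by (simp only: fibre_measure_def acip_def)
qed

section \<open>The series \<open>x_shift\<close> and its recurrence\<close>

lemma x_shift_eq:
  assumes bs: "alternate_base bs"
  shows "x_shift bs i = (\<Sum>n. (of_int \<lceil>base_at bs (int (i + n))\<rceil> - 1) / (\<Prod>k\<le>n. base_at bs (int (i + k))))"
proof -
  have "base_at (shift_base bs (int i)) (int k) = base_at bs (int (i + k))" for k
  proof -
    have "nat (int k mod int (length bs)) < length bs"
      using bs by (simp add: alternate_base_def nat_less_iff)
    moreover have "shift_base bs (int i) ! j = base_at bs (int i + int j)" if "j < length bs" for j
      using that by (simp add: shift_base_def)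
    moreover have "base_at (shift_base bs (int i)) (int k) =
        shift_base bs (int i) ! nat (int k mod int (length bs))"
      by (simp only: base_at_def) (simp add: shift_base_def)
    ultimately have "base_at (shift_base bs (int i)) (int k) =
        base_at bs (int i + int (nat (int k mod int (length bs))))"
      by simp
    also have "\<dots> = base_at bs (int i + int k mod int (length bs))"
      using bs by (simp add: alternate_base_def)
    \<comment> \<open>Reducing \<open>k\<close> within the shifted list and then the sum within
      \<open>bs\<close> agrees with a single reduction of \<open>i + k\<close>.\<close>
    also have "\<dots> = base_at bs (int (i + k))"
      by (rule base_at_cong) (simp add: mod_add_right_eq)
    finally show ?thesis .
  qed
  then show ?thesis by (simp only: x_max_def)
qed

lemma x_shift_mod:
  assumes bs: "alternate_base bs"
  shows "x_shift bs (i mod length bs) = x_shift bs i"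
proof -
  have "base_at bs (int (i mod length bs + k)) = base_at bs (int (i + k))" for k
    by (rule base_at_cong) (simp add: zmod_int mod_add_left_eq)
  then show ?thesis by (simp only: x_shift_eq[OF bs])
qed

text \<open>The numerator is at most the last factor of the product; the \<open>n\<close> factors
  that remain are at least \<open>Min (set bs)\<close>.\<close>

lemma x_shift_term:
  assumes bs: "alternate_base bs"
  shows "0 \<le> (of_int \<lceil>base_at bs (int (i + n))\<rceil> - 1) / (\<Prod>k\<le>n. base_at bs (int (i + k)))"
    and "(of_int \<lceil>base_at bs (int (i + n))\<rceil> - 1) / (\<Prod>k\<le>n. base_at bs (int (i + k)))
      \<le> (1 / Min (set bs)) ^ n"
proof -
  let ?c = "\<lambda>k. base_at bs (int (i + k))" and ?b = "Min (set bs)"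
  have c: "1 < ?c k" "?b \<le> ?c k" for k by (rule alternate_base_ge[OF bs])+
  have c0: "0 \<le> ?c k" "0 < ?c k" for k using c(1)[of k] by linarith+
  have P: "0 < (\<Prod>k<n. ?c k)" by (intro prod_pos c0(2))
  have "1 \<le> \<lceil>?c n\<rceil>" using c(1)[of n] by linarith
  then have "0 \<le> (of_int \<lceil>?c n\<rceil> - 1 :: real)" by simp
  then show "0 \<le> (of_int \<lceil>?c n\<rceil> - 1) / (\<Prod>k\<le>n. ?c k)"
    by (rule divide_nonneg_nonneg[OF _ prod_nonneg[OF c0(1)]])
  have "of_int \<lceil>?c n\<rceil> - 1 \<le> ?c n" by (rule of_int_ceiling_diff_one_le)
  then have "(of_int \<lceil>?c n\<rceil> - 1) / (\<Prod>k\<le>n. ?c k) \<le> ?c n / (\<Prod>k\<le>n. ?c k)"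
    by (rule divide_right_mono[OF _ prod_nonneg[OF c0(1)]])
  also have "\<dots> = 1 / (\<Prod>k<n. ?c k)"
    unfolding lessThan_Suc_atMost[symmetric] prod.lessThan_Suc using c0(2)[of n] by simp
  also have "\<dots> \<le> 1 / ?b ^ n"
  proof -
    have "(\<Prod>k<n. ?b) \<le> (\<Prod>k<n. ?c k)"
      using alternate_base_ge(1)[OF bs] c(2) by (intro prod_mono) auto
    then show ?thesis using alternate_base_ge(1)[OF bs] P by (intro divide_left_mono) auto
  qed
  finally show "(of_int \<lceil>?c n\<rceil> - 1) / (\<Prod>k\<le>n. ?c k) \<le> (1 / ?b) ^ n"
    by (simp add: power_one_over)
qed

lemma x_shift_summable:
  assumes bs: "alternate_base bs"
  shows "summable (\<lambda>n. (of_int \<lceil>base_at bs (int (i + n))\<rceil> - 1) / (\<Prod>k\<le>n. base_at bs (int (i + k))))"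
proof (rule summable_comparison_test'[where N = 0])
  show "summable (\<lambda>n. (1 / Min (set bs)) ^ n)"
    using alternate_base_ge(1)[OF bs] by (intro summable_geometric) simp
qed (simp only: real_norm_def abs_of_nonneg[OF x_shift_term(1)[OF bs]] x_shift_term(2)[OF bs])

text \<open>Splitting off the head of the series leaves the series at \<open>Suc i\<close> divided
  by \<open>base_at bs (int i)\<close>.\<close>

lemma x_shift_recurrence:
  assumes bs: "alternate_base bs"
  shows "base_at bs (int i) * x_shift bs i = of_int \<lceil>base_at bs (int i)\<rceil> - 1 + x_shift bs (Suc i)"
proof -
  define t where "t j n = (of_int \<lceil>base_at bs (int (j + n))\<rceil> - 1) / (\<Prod>k\<le>n. base_at bs (int (j + k)))"
    for j n
  have x: "x_shift bs j = (\<Sum>n. t j n)" for j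
    unfolding t_def by (rule x_shift_eq[OF bs])
  have s: "summable (t j)" for j
    unfolding t_def by (rule x_shift_summable[OF bs])
  have c: "1 < base_at bs (int i)" by (rule alternate_base_ge[OF bs])
  have "t i (Suc n) = t (Suc i) n / base_at bs (int i)" for n
    by (simp only: t_def prod.atMost_Suc_shift add_Suc add_Suc_right add_0_right
        divide_divide_eq_left mult.commute[of "base_at bs (int i)"])
  then have "(\<Sum>n. t i (Suc n)) = x_shift bs (Suc i) / base_at bs (int i)"
    unfolding x using suminf_divide[OF s] by simp
  moreover have "(\<Sum>n. t i (Suc n)) = x_shift bs i - t i 0"
    unfolding x by (rule suminf_split_head[OF s])
  moreover have "t i 0 = (of_int \<lceil>base_at bs (int i)\<rceil> - 1) / base_at bs (int i)"
    by (simp add: t_def)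
  ultimately show ?thesis using c by (simp add: field_simps)
qed

text \<open>The recurrence contracts the defect \<open>1 - x_shift bs i\<close>, which is at most 1.\<close>

lemma x_shift_ge_1:
  assumes bs: "alternate_base bs"
  shows "1 \<le> x_shift bs i"
proof -
  let ?b = "Min (set bs)"
  have b: "1 < ?b" by (rule alternate_base_ge[OF bs])
  have "1 - x_shift bs j \<le> (1 / ?b) ^ n" for n j
  proof (induction n arbitrary: j)
    case 0
    have "0 \<le> x_shift bs j"
      unfolding x_shift_eq[OF bs] by (rule suminf_nonneg[OF x_shift_summable[OF bs] x_shift_term(1)[OF bs]])
    then show ?case by simp
  next
    case (Suc n)
    let ?c = "base_at bs (int j)"
    have c: "1 < ?c" "?b \<le> ?c" by (rule alternate_base_ge[OF bs])+
    \<comment> \<open>By the recurrence the two sides differ by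
      \<open>\<lceil>?c\<rceil> - ?c\<close>, which is nonnegative.\<close>
    have "?c * (1 - x_shift bs j) \<le> 1 - x_shift bs (Suc j)"
      using x_shift_recurrence[OF bs, of j] le_of_int_ceiling[of ?c] by (simp add: right_diff_distrib)
    also have "\<dots> \<le> (1 / ?b) ^ n" by (rule Suc.IH)
    finally have "(1 - x_shift bs j) * ?c \<le> (1 / ?b) ^ n" by (simp only: mult.commute)
    moreover have "0 < ?c" using c by linarith
    ultimately have "1 - x_shift bs j \<le> (1 / ?b) ^ n / ?c" by (simp only: pos_le_divide_eq)
    also have "\<dots> \<le> (1 / ?b) ^ n / ?b" using c b by (intro divide_left_mono) auto
    finally show ?case by (simp add: mult.commute)
  qed
  then have "1 - x_shift bs i \<le> 0"
    using b by (intro LIMSEQ_le_const[OF LIMSEQ_realpow_zero[of "1 / ?b"]]) auto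
  then show ?thesis by simp
qed

section \<open>The isomorphism\<close>

text \<open>The section over \<open>i\<close> of a preimage is, within \<open>X i\<close>, the
  preimage under \<open>t i\<close> of the section over \<open>s i\<close>. This one criterion
  serves the greedy map and the flip in both directions.\<close>

lemma layered_measurable:
  assumes X: "\<And>i. i < p \<Longrightarrow> X i \<in> sets borel" and Y: "\<And>i. i < p \<Longrightarrow> Y i \<in> sets borel"
    and M: "space M = layered_space p X" "sets M = layered_sets p X"
    and N: "space N = layered_space p Y" "sets N = layered_sets p Y"
    and s: "\<And>i. i < p \<Longrightarrow> s i < p" and t: "\<And>i. i < p \<Longrightarrow> t i \<in> borel_measurable borel"
    and F: "\<And>i x. i < p \<Longrightarrow> x \<in> X i \<Longrightarrow> F (i, x) = (s i, t i x) \<and> t i x \<in> Y (s i)"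
  shows "F \<in> measurable M N"
proof (rule measurableI)
  show "F z \<in> space N" if "z \<in> space M" for z
    using that F s unfolding M N layered_space_def by force
  fix A assume "A \<in> sets N"
  then have A: "Pair i -` A \<in> sets borel" if "i < p" for i
    using that Y[OF that] by (auto simp: N mem_layered_sets_iff sets_restrict_space_iff)
  have "Pair i -` (F -` A \<inter> space M) \<in> sets (restrict_space borel (X i))" if i: "i < p" for i
  proof -
    have "Pair i -` (F -` A \<inter> space M) = X i \<inter> t i -` (Pair (s i) -` A)"
      using F[OF i] i by (auto simp: M layered_space_def)
    moreover have "t i -` (Pair (s i) -` A) \<in> sets borel"
      using measurable_sets[OF t[OF i] A[OF s[OF i]]] by simp
    ultimately show ?thesis using X[OF i] by (simp add: sets_restrict_space_iff)
  qed
  then show "F -` A \<inter> space M \<in> sets M"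
    unfolding M mem_layered_sets_iff by (auto simp: layered_space_def)
qed

section \<open>The greedy measure and its invariance\<close>

lemma layered_section_unit:
  assumes "A \<in> layered_sets p (greedy_fibre bs)" "i < p"
  shows "Pair i -` A \<inter> {0..<1} \<in> sets unit_lborel"
  using assms by (auto simp: mem_layered_sets_iff sets_restrict_space_iff)

text \<open>\<open>measure_of\<close> returns the given set function only once it is known to be
  countably additive. That reduces to the fibre measures, since disjoint sets have disjoint
  sections.\<close>

lemma emeasure_greedy_measure:
  assumes bs: "alternate_base bs" and A: "A \<in> layered_sets (length bs) (greedy_fibre bs)"
  shows "emeasure (greedy_measure bs) A =
    (\<Sum>i<length bs. emeasure (fibre_measure bs i) (Pair i -` A \<inter> {0..<1})) / of_nat (length bs)"
proof -
  let ?m = "\<lambda>A. (\<Sum>i<length bs. emeasure (fibre_measure bs i) (Pair i -` A \<inter> {0..<1})) / of_nat (length bs)"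
  note sets = sets_fibre_measure[OF bs]
  have "countably_additive (layered_sets (length bs) (greedy_fibre bs)) ?m"
  proof (rule countably_additiveI)
    fix A :: "nat \<Rightarrow> (nat \<times> real) set"
    assume A: "range A \<subseteq> layered_sets (length bs) (greedy_fibre bs)" "disjoint_family A"
    have sum: "(\<Sum>n. emeasure (fibre_measure bs i) (Pair i -` A n \<inter> {0..<1})) =
        emeasure (fibre_measure bs i) (Pair i -` (\<Union>n. A n) \<inter> {0..<1})" if i: "i < length bs" for i
    proof -
      have "(\<Sum>n. emeasure (fibre_measure bs i) (Pair i -` A n \<inter> {0..<1})) =
          emeasure (fibre_measure bs i) (\<Union>n. Pair i -` A n \<inter> {0..<1})"
      proof (rule suminf_emeasure)
        show "range (\<lambda>n. Pair i -` A n \<inter> {0..<1}) \<subseteq> sets (fibre_measure bs i)"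
          unfolding sets using layered_section_unit[OF _ i] A(1) by blast
        show "disjoint_family (\<lambda>n. Pair i -` A n \<inter> {0..<1})"
          using A(2) unfolding disjoint_family_on_def by blast
      qed
      also have "(\<Union>n. Pair i -` A n \<inter> {0..<1}) = Pair i -` (\<Union>n. A n) \<inter> {0..<1}" by auto
      finally show ?thesis .
    qed
    have "(\<Sum>n. ?m (A n)) =
        (\<Sum>n. \<Sum>i<length bs. emeasure (fibre_measure bs i) (Pair i -` A n \<inter> {0..<1})) / of_nat (length bs)"
      by (rule ennreal_suminf_divide)
    also have "(\<Sum>n. \<Sum>i<length bs. emeasure (fibre_measure bs i) (Pair i -` A n \<inter> {0..<1})) =
        (\<Sum>i<length bs. \<Sum>n. emeasure (fibre_measure bs i) (Pair i -` A n \<inter> {0..<1}))"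
      by (rule suminf_sum) simp
    also have "\<dots> = (\<Sum>i<length bs. emeasure (fibre_measure bs i) (Pair i -` (\<Union>n. A n) \<inter> {0..<1}))"
      by (rule sum.cong) (simp_all only: sum lessThan_iff)
    finally show "(\<Sum>n. ?m (A n)) = ?m (\<Union>n. A n)" .
  qed
  moreover have "positive (layered_sets (length bs) (greedy_fibre bs)) ?m"
    by (simp add: positive_def)
  ultimately show ?thesis
    unfolding greedy_measure_def
    by (intro emeasure_measure_of_sigma sigma_algebra_layered_sets A)
qed

lemma prob_space_greedy_measure:
  assumes bs: "alternate_base bs"
  shows "prob_space (greedy_measure bs)"
proof (rule prob_spaceI)
  let ?X = "layered_space (length bs) (greedy_fibre bs)"
  have X: "?X \<in> layered_sets (length bs) (greedy_fibre bs)"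
    using sets.top[of "greedy_measure bs"] by (simp only: space_greedy_measure sets_greedy_measure)
  have "emeasure (fibre_measure bs i) (Pair i -` ?X \<inter> {0..<1}) = 1" if "i < length bs" for i
  proof -
    have M: "prob_space (fibre_measure bs i)" "sets (fibre_measure bs i) = sets unit_lborel"
      using is_acip_fibre_measure[OF bs] unfolding is_acip_def by blast+
    \<comment> \<open>The layer contains \<open>[0, 1)\<close> because \<open>x_shift bs i\<close>
      is at least 1.\<close>
    have "Pair i -` ?X \<inter> {0..<1} = {0..<1}"
      using that x_shift_ge_1[OF bs, of i] by (auto simp: layered_space_def)
    also have "\<dots> = space (fibre_measure bs i)"
      by (simp only: sets_eq_imp_space_eq[OF M(2)] space_unit_lborel)
    finally show ?thesis using prob_space.emeasure_space_1[OF M(1)] by simp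
  qed
  then show "emeasure (greedy_measure bs) (space (greedy_measure bs)) = 1"
    using bs unfolding space_greedy_measure emeasure_greedy_measure[OF bs X]
    by (simp add: alternate_base_def ennreal_of_nat_eq_real_of_nat divide_ennreal)
qed

text \<open>Below 1 the image is a fractional part, and the next \<open>x_shift\<close> is at least
  1. From 1 on, the subtracted \<open>\<lceil>\<beta>\<rceil> - 1\<close> is at most
  \<open>\<beta> * x\<close>, and the recurrence turns \<open>x < x_shift bs i\<close> into the
  upper bound for the next layer.\<close>

lemma greedy_map_fibre:
  assumes bs: "alternate_base bs" and x: "x \<in> greedy_fibre bs i"
  shows "snd (greedy_map bs (i, x)) \<in> greedy_fibre bs (Suc i mod length bs)"
proof (cases "x < 1")
  case True
  have "0 \<le> base_at bs (int i) * x - of_int \<lfloor>base_at bs (int i) * x\<rfloor>"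
    "base_at bs (int i) * x - of_int \<lfloor>base_at bs (int i) * x\<rfloor> < 1" by linarith+
  then show ?thesis
    using True x_shift_ge_1[OF bs, of "Suc i"] by (simp add: greedy_map_def x_shift_mod[OF bs])
next
  case False
  let ?c = "base_at bs (int i)"
  have c: "0 < ?c" using alternate_base_ge(3)[OF bs, of "int i"] by simp
  have "?c * 1 \<le> ?c * x" "?c * x < ?c * x_shift bs i"
    using False x c by (auto intro: mult_left_mono mult_strict_left_mono)
  moreover from this have "of_int \<lceil>?c\<rceil> - 1 \<le> ?c * x"
    using of_int_ceiling_diff_one_le[of ?c] by linarith
  ultimately show ?thesis
    using False x_shift_recurrence[OF bs, of i]
    by (simp add: greedy_map_def x_shift_mod[OF bs])
qed

lemma measurable_greedy_map:
  assumes bs: "alternate_base bs"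
  shows "greedy_map bs \<in> measurable (greedy_measure bs) (greedy_measure bs)"
proof (rule layered_measurable[where p = "length bs" and X = "greedy_fibre bs" and Y = "greedy_fibre bs"
    and s = "\<lambda>i. Suc i mod length bs" and t = "\<lambda>i x. snd (greedy_map bs (i, x))"])
  show "(\<lambda>x. snd (greedy_map bs (i, x))) \<in> borel_measurable borel" for i
    unfolding greedy_map_def by simp
  show "greedy_map bs (i, x) = (Suc i mod length bs, snd (greedy_map bs (i, x))) \<and>
      snd (greedy_map bs (i, x)) \<in> greedy_fibre bs (Suc i mod length bs)"
    if "x \<in> greedy_fibre bs i" for i x
    using greedy_map_fibre[OF bs that] by (simp add: greedy_map_def)
  show "Suc i mod length bs < length bs" for i using bs by (simp add: alternate_base_def)
qed (simp_all add: space_greedy_measure sets_greedy_measure)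

lemma bij_betw_Suc_mod:
  assumes "0 < p"
  shows "bij_betw (\<lambda>i. Suc i mod p) {..<p} {..<p}"
proof -
  have "inj_on (\<lambda>i. Suc i mod p) {..<p}"
    by (rule inj_onI) (auto simp: mod_Suc split: if_splits)
  moreover have "(\<lambda>i. Suc i mod p) ` {..<p} \<subseteq> {..<p}" using assms by auto
  ultimately show ?thesis
    by (simp add: bij_betw_def endo_inj_surj)
qed

text \<open>The measure lives on \<open>[0, 1)\<close>, where the greedy map acts as
  \<open>beta_map\<close> into the next layer, so \<open>fibre_measure_Suc\<close> matches the
  contributions of consecutive layers. Going round the cycle only permutes the summands.\<close>

lemma preserves_measure_greedy_map:
  assumes bs: "alternate_base bs"
  shows "preserves_measure (greedy_measure bs) (greedy_map bs)"
  unfolding preserves_measure_def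
proof (intro conjI ballI measurable_greedy_map[OF bs])
  fix A assume A: "A \<in> sets (greedy_measure bs)"
  let ?p = "length bs" and ?T = "greedy_map bs -` A \<inter> space (greedy_measure bs)"
  let ?s = "\<lambda>i. Suc i mod length bs"
  have p: "0 < ?p" using bs by (simp add: alternate_base_def)
  have A': "A \<in> layered_sets ?p (greedy_fibre bs)" using A by (simp only: sets_greedy_measure)
  have T: "?T \<in> layered_sets ?p (greedy_fibre bs)"
    using measurable_sets[OF measurable_greedy_map[OF bs] A] by (simp only: sets_greedy_measure)
  have "emeasure (fibre_measure bs i) (Pair i -` ?T \<inter> {0..<1}) =
      emeasure (fibre_measure bs (?s i)) (Pair (?s i) -` A \<inter> {0..<1})" if i: "i < ?p" for i
  proof -
    let ?A = "Pair (?s i) -` A \<inter> {0..<1}"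
    have "?s i < ?p" using p by simp
    from layered_section_unit[OF A' this]
    have "emeasure (fibre_measure bs (?s i)) ?A =
      emeasure (fibre_measure bs i) (beta_map (base_at bs (int i)) -` ?A \<inter> space unit_lborel)"
      unfolding fibre_measure_mod by (rule fibre_measure_Suc[OF bs])
    \<comment> \<open>As \<open>beta_map\<close> takes values in \<open>[0, 1)\<close>, cutting the
      section of \<open>A\<close> to that interval loses no points of the preimage.\<close>
    also have "beta_map (base_at bs (int i)) -` ?A \<inter> space unit_lborel = Pair i -` ?T \<inter> {0..<1}"
    proof -
      have "0 \<le> beta_map (base_at bs (int i)) x \<and> beta_map (base_at bs (int i)) x < 1" for x
        unfolding beta_map_def by linarith
      moreover have "greedy_map bs (i, x) = (?s i, beta_map (base_at bs (int i)) x)" if "x < 1" for x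
        using that by (simp add: greedy_map_def beta_map_def)
      ultimately show ?thesis
        using i x_shift_ge_1[OF bs, of i]
        by (auto simp: space_unit_lborel space_greedy_measure layered_space_def)
    qed
    finally show ?thesis ..
  qed
  then have "(\<Sum>i<?p. emeasure (fibre_measure bs i) (Pair i -` ?T \<inter> {0..<1})) =
      (\<Sum>i<?p. emeasure (fibre_measure bs (?s i)) (Pair (?s i) -` A \<inter> {0..<1}))"
    by (intro sum.cong) (simp_all only: lessThan_iff)
  also have "\<dots> = (\<Sum>i<?p. emeasure (fibre_measure bs i) (Pair i -` A \<inter> {0..<1}))"
    by (rule sum.reindex_bij_betw[OF bij_betw_Suc_mod[OF p]])
  finally show "emeasure (greedy_measure bs) ?T = emeasure (greedy_measure bs) A"
    unfolding emeasure_greedy_measure[OF bs A'] emeasure_greedy_measure[OF bs T] by simp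
qed

section \<open>The flip and the lazy map\<close>

lemma measurable_flip_map:
  assumes bs: "alternate_base bs"
  shows "flip_map bs \<in> measurable (greedy_measure bs) (lazy_algebra bs)"
    and "flip_map bs \<in> measurable (lazy_algebra bs) (greedy_measure bs)"
proof -
  have t: "(\<lambda>x. x_shift bs i - x) \<in> borel_measurable borel" for i by simp
  show "flip_map bs \<in> measurable (greedy_measure bs) (lazy_algebra bs)"
    by (rule layered_measurable[where p = "length bs" and X = "greedy_fibre bs" and Y = "lazy_fibre bs"
          and s = "\<lambda>i. i" and t = "\<lambda>i x. x_shift bs i - x"])
      (auto simp: space_greedy_measure sets_greedy_measure space_lazy_algebra sets_lazy_algebra flip_map_def)
  show "flip_map bs \<in> measurable (lazy_algebra bs) (greedy_measure bs)"
    by (rule layered_measurable[where p = "length bs" and X = "lazy_fibre bs" and Y = "greedy_fibre bs"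
          and s = "\<lambda>i. i" and t = "\<lambda>i x. x_shift bs i - x"])
      (auto simp: space_greedy_measure sets_greedy_measure space_lazy_algebra sets_lazy_algebra flip_map_def)
qed

lemma flip_map_flip_map: "flip_map bs (flip_map bs z) = z"
  by (simp add: flip_map_def split_beta)

text \<open>The flip turns \<open>x < 1\<close> into the second case of the lazy map and
  \<open>1 \<le> x\<close> into the first; the recurrence then matches the values.\<close>

lemma lazy_map_flip_map:
  assumes bs: "alternate_base bs"
  shows "lazy_map bs (flip_map bs z) = flip_map bs (greedy_map bs z)"
proof (cases z)
  case (Pair i x)
  let ?c = "base_at bs (int i)"
  have rec: "?c * (x_shift bs i - x) = of_int \<lceil>?c\<rceil> - 1 + x_shift bs (Suc i) - ?c * x"
    unfolding right_diff_distrib x_shift_recurrence[OF bs] ..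
  show ?thesis
  proof (cases "x < 1")
    case True
    \<comment> \<open>By the recurrence the argument is the integer
      \<open>\<lceil>?c\<rceil> - 1\<close> minus \<open>?c * x\<close>, so the ceiling becomes a
      floor with the opposite sign.\<close>
    have "\<lceil>?c * (x_shift bs i - x) - x_shift bs (Suc i)\<rceil> = \<lceil>?c\<rceil> - 1 - \<lfloor>?c * x\<rfloor>"
      unfolding rec by linarith
    then show ?thesis
      using True rec by (simp add: Pair flip_map_def lazy_map_def greedy_map_def x_shift_mod[OF bs])
  next
    case False
    then show ?thesis
      using rec by (simp add: Pair flip_map_def lazy_map_def greedy_map_def x_shift_mod[OF bs])
  qed
qed

text \<open>The commutation turns preimages under \<open>S\<close> into preimages under
  \<open>T\<close>, where invariance is known.\<close>

lemma dynamical_system_distr: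
  assumes M: "dynamical_system M T" and f: "f \<in> measurable M N" and S: "S \<in> measurable N N"
    and comm: "\<And>x. x \<in> space M \<Longrightarrow> S (f x) = f (T x)"
  shows "dynamical_system (distr M N f) S"
proof -
  have T: "T \<in> measurable M M" "\<And>A. A \<in> sets M \<Longrightarrow> emeasure M (T -` A \<inter> space M) = emeasure M A"
    and "prob_space M"
    using M by (auto simp: dynamical_system_def preserves_measure_def)
  interpret prob_space M by fact
  show ?thesis
    unfolding dynamical_system_def preserves_measure_def
  proof (intro conjI ballI prob_space_distr[OF f])
    show "S \<in> measurable (distr M N f) (distr M N f)" using S by simp
    fix A assume "A \<in> sets (distr M N f)"
    then have A: "A \<in> sets N" by simp
    have "emeasure (distr M N f) (S -` A \<inter> space N) = emeasure M (f -` (S -` A \<inter> space N) \<inter> space M)"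
      by (rule emeasure_distr[OF f measurable_sets[OF S A]])
    also have "f -` (S -` A \<inter> space N) \<inter> space M = T -` (f -` A \<inter> space M) \<inter> space M"
      using comm measurable_space[OF f] measurable_space[OF T(1)] by auto
    also have "emeasure M \<dots> = emeasure M (f -` A \<inter> space M)"
      by (rule T(2)[OF measurable_sets[OF f A]])
    finally show "emeasure (distr M N f) (S -` A \<inter> space (distr M N f)) = emeasure (distr M N f) A"
      by (simp add: emeasure_distr[OF f A])
  qed
qed

theorem theorem30:
  fixes p :: nat and \<beta> :: "real list"
  assumes "p \<ge> 1" and "length \<beta> = p" and "\<forall>i<p. \<beta> ! i > 1"
  shows "isomorphic_via (greedy_measure \<beta>) (greedy_map \<beta>) (lazy_measure \<beta>) (lazy_map \<beta>) (flip_map \<beta>)"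
proof -
  have bs: "alternate_base \<beta>"
    using assms by (auto simp: alternate_base_def in_set_conv_nth)
  let ?M = "greedy_measure \<beta>" and ?N = "lazy_algebra \<beta>"
  note f = measurable_flip_map[OF bs]
  have greedy: "dynamical_system ?M (greedy_map \<beta>)"
    unfolding dynamical_system_def
    using prob_space_greedy_measure[OF bs] preserves_measure_greedy_map[OF bs] by blast
  \<comment> \<open>The flip is an involution, so the lazy map is the greedy map conjugated by it
    and inherits measurability.\<close>
  have "(\<lambda>z. flip_map \<beta> (greedy_map \<beta> (flip_map \<beta> z))) \<in> measurable ?N ?N"
    by (rule measurable_compose[OF measurable_compose[OF f(2) measurable_greedy_map[OF bs]] f(1)])
  then have S: "lazy_map \<beta> \<in> measurable ?N ?N"
    unfolding lazy_map_flip_map[OF bs, symmetric] flip_map_flip_map .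
  have lazy: "dynamical_system (lazy_measure \<beta>) (lazy_map \<beta>)"
    unfolding lazy_measure_def
    by (rule dynamical_system_distr[OF greedy f(1) S lazy_map_flip_map[OF bs]])
  show ?thesis
    unfolding isomorphic_via_def
  proof (intro conjI greedy lazy)
    show "flip_map \<beta> \<in> measurable ?M (lazy_measure \<beta>)"
      using f(1) by (simp add: lazy_measure_def)
    \<comment> \<open>The flip is its own inverse, so the exceptional null set can be empty.\<close>
    show "\<exists>Z\<in>null_sets ?M. inj_on (flip_map \<beta>) (space ?M - Z)"
      by (intro bexI[of _ "{}"] inj_on_inverseI[of _ "flip_map \<beta>"]) (simp_all add: flip_map_flip_map)
    show "\<forall>B\<in>sets (lazy_measure \<beta>). emeasure (lazy_measure \<beta>) B = emeasure ?M (flip_map \<beta> -` B \<inter> space ?M)"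
      using emeasure_distr[OF f(1)] by (simp add: lazy_measure_def)
    show "AE z in ?M. flip_map \<beta> (greedy_map \<beta> z) = lazy_map \<beta> (flip_map \<beta> z)"
      by (rule AE_I2) (simp only: lazy_map_flip_map[OF bs])
  qed
qed

end
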